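(* Let $A=\mathrm{diag}(\lambda,\mu)\in\mathrm{SL}(2,\mathbb H)$ with $\lambda\not\sim\mu$. Then $$\mathrm Z_{\mathrm{GL}(2,\mathbb H)}(A)=\{\mathrm{diag}(q,p):\ q\in\mathrm Z_{\mathbb H^*}(\lambda),\ p\in\mathrm Z_{\mathbb H^*}(\mu)\}.$$ If moreover $A$ is regular loxodromic, say $\lambda=re^{I\theta}$ and $\mu=r^{-1}e^{J\varphi}$ with $\theta,\varphi\in(0,\pi)$, then $$\mathrm Z_{\mathrm{SL}(2,\mathbb H)}(A)=\bigl\{\mathrm{diag}(te^{I\sigma},t^{-1}e^{J\tau}): t>0,\ \sigma,\tau\in\mathbb R/2\pi\mathbb Z\bigr\}\cong\mathbb R_{>0}\times\mathrm U(1)\times\mathrm U(1),$$ a group of real dimension $3$. If $A$ is loxodromic but not regular, the centralizer $\mathrm Z_{\mathrm{SL}(2,\mathbb H)}(A)$ has dimension $5$ or $7$, according as one or both of $\lambda,\mu$ are real.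
   Context: $\mathbb H$ denotes the quaternions with norm $|\cdot|$, $\mathbb H^*=\mathbb H\setminus\{0\}$, $\mathbb S^2=\{I\in\mathbb H: I^2=-1\}$, $e^{I\theta}=\cos\theta+I\sin\theta$ for $I\in\mathbb S^2$. Quaternions are similar, $\lambda\sim\mu$, if $\mu=p\lambda p^{-1}$ for some $p\in\mathbb H^*$. $\mathrm Z_G(x)$ denotes the centralizer of $x$ in $G$. The Dieudonné determinant of $\left(\begin{smallmatrix}a&b\\c&d\end{smallmatrix}\right)\in\mathrm{GL}(2,\mathbb H)$ is $|ad-aca^{-1}b|$ if $a\neq0$ and $|cb|$ if $a=0$ (so $|\lambda||\mu|$ for $\mathrm{diag}(\lambda,\mu)$); $\mathrm{SL}(2,\mathbb H)$ is the group of matrices of Dieudonné determinant $1$. $A\in\mathrm{SL}(2,\mathbb H)$ is loxodromic if it is conjugate in $\mathrm{SL}(2,\mathbb H)$ to $\mathrm{diag}(re^{I\theta},r^{-1}e^{J\varphi})$ with $r>1$, $\theta,\varphi\in[0,\pi]$, $I,J\in\mathbb S^2$; it is regular loxodromic if moreover $\theta,\varphi\in(0,\pi)$. *)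

theory Defs
  imports "HOL-Analysis.Analysis" "HOL-Algebra.Group"
begin

section \<open>The quaternions\<close>

codatatype quat = Quat (qre: real) (qi: real) (qj: real) (qk: real)

lemma quat_eq_iff: "x = y \<longleftrightarrow> qre x = qre y \<and> qi x = qi y \<and> qj x = qj y \<and> qk x = qk y"
  by (auto intro: quat.expand)

instantiation quat :: ab_group_add
begin

primcorec zero_quat where
  "qre 0 = 0" | "qi 0 = 0" | "qj 0 = 0" | "qk 0 = 0"

primcorec plus_quat where
  "qre (x + y) = qre x + qre y"
| "qi (x + y) = qi x + qi y"
| "qj (x + y) = qj x + qj y"
| "qk (x + y) = qk x + qk y"

primcorec uminus_quat where
  "qre (- x) = - qre x" | "qi (- x) = - qi x" | "qj (- x) = - qj x" | "qk (- x) = - qk x"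

primcorec minus_quat where
  "qre (x - y) = qre x - qre y"
| "qi (x - y) = qi x - qi y"
| "qj (x - y) = qj x - qj y"
| "qk (x - y) = qk x - qk y"

instance
  by standard (simp_all add: quat_eq_iff)

end

instantiation quat :: ring_1
begin

primcorec one_quat where
  "qre 1 = 1" | "qi 1 = 0" | "qj 1 = 0" | "qk 1 = 0"

primcorec times_quat where
  "qre (x * y) = qre x * qre y - qi x * qi y - qj x * qj y - qk x * qk y"
| "qi (x * y) = qre x * qi y + qi x * qre y + qj x * qk y - qk x * qj y"
| "qj (x * y) = qre x * qj y - qi x * qk y + qj x * qre y + qk x * qi y"
| "qk (x * y) = qre x * qk y + qi x * qj y - qj x * qi y + qk x * qre y"

instance
  by standard (simp_all add: quat_eq_iff algebra_simps)

end

instantiation quat :: real_algebra_1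
begin

primcorec scaleR_quat where
  "qre (scaleR r x) = r * qre x"
| "qi (scaleR r x) = r * qi x"
| "qj (scaleR r x) = r * qj x"
| "qk (scaleR r x) = r * qk x"

instance
  by standard (simp_all add: quat_eq_iff algebra_simps)

end

instantiation quat :: real_inner
begin

definition inner_quat :: "quat \<Rightarrow> quat \<Rightarrow> real"
  where "inner x y = qre x * qre y + qi x * qi y + qj x * qj y + qk x * qk y"

definition norm_quat :: "quat \<Rightarrow> real"
  where "norm x = sqrt ((qre x)\<^sup>2 + (qi x)\<^sup>2 + (qj x)\<^sup>2 + (qk x)\<^sup>2)"

definition sgn_quat :: "quat \<Rightarrow> quat"
  where "sgn x = (x::quat) /\<^sub>R norm x"

definition dist_quat :: "quat \<Rightarrow> quat \<Rightarrow> real"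
  where "dist x y = norm (x - y :: quat)"

definition uniformity_quat :: "(quat \<times> quat) filter"
  where "uniformity = (INF e\<in>{0 <..}. principal {(x, y). dist x (y::quat) < e})"

definition open_quat :: "quat set \<Rightarrow> bool"
  where "open (U :: quat set) \<longleftrightarrow> (\<forall>x\<in>U. eventually (\<lambda>(x', y). x' = x \<longrightarrow> y \<in> U) uniformity)"

instance
proof
  fix x y z :: quat and r :: real and U :: "quat set"
  show "sgn x = x /\<^sub>R norm x" by (rule sgn_quat_def)
  show "dist x y = norm (x - y)" by (rule dist_quat_def)
  show "uniformity = (INF e\<in>{0 <..}. principal {(x, y). dist x (y::quat) < e})"
    by (rule uniformity_quat_def)
  show "open U \<longleftrightarrow> (\<forall>x\<in>U. eventually (\<lambda>(x', y). x' = x \<longrightarrow> y \<in> U) uniformity)"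
    by (rule open_quat_def)
  show "inner x y = inner y x" "inner (x + y) z = inner x z + inner y z"
    "inner (r *\<^sub>R x) y = r * inner x y"
    by (simp_all add: inner_quat_def algebra_simps)
  show "0 \<le> inner x x" by (simp add: inner_quat_def)
  have "inner x x = 0 \<longleftrightarrow> (qre x)\<^sup>2 + (qi x)\<^sup>2 + ((qj x)\<^sup>2 + (qk x)\<^sup>2) = 0"
    by (simp add: inner_quat_def power2_eq_square add.assoc)
  also have "\<dots> \<longleftrightarrow> x = 0"
    by (subst add_nonneg_eq_0_iff) (auto simp: quat_eq_iff sum_power2_eq_zero_iff)
  finally show "inner x x = 0 \<longleftrightarrow> x = 0" .
  show "norm x = sqrt (inner x x)"
    by (simp add: norm_quat_def inner_quat_def power2_eq_square)
qed

end

lemma quat_norm_sq: "(norm x)\<^sup>2 = (qre x)\<^sup>2 + (qi x)\<^sup>2 + (qj x)\<^sup>2 + (qk x)\<^sup>2" for x :: quat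
  by (simp add: norm_quat_def)

primcorec qcnj :: "quat \<Rightarrow> quat" where
  "qre (qcnj x) = qre x"
| "qi (qcnj x) = - qi x"
| "qj (qcnj x) = - qj x"
| "qk (qcnj x) = - qk x"

lemma mult_qcnj: "x * qcnj x = ((norm x)\<^sup>2) *\<^sub>R 1" and qcnj_mult: "qcnj x * x = ((norm x)\<^sup>2) *\<^sub>R 1"
  unfolding quat_norm_sq by (simp_all add: quat_eq_iff power2_eq_square algebra_simps)

instantiation quat :: real_normed_div_algebra
begin

definition inverse_quat :: "quat \<Rightarrow> quat"
  where "inverse x = qcnj x /\<^sub>R (norm x)\<^sup>2"

definition divide_quat :: "quat \<Rightarrow> quat \<Rightarrow> quat"
  where "x div y = x * inverse y" for x y :: quat

instance
proof
  fix x y :: quat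
  show "x \<noteq> 0 \<Longrightarrow> inverse x * x = 1" "x \<noteq> 0 \<Longrightarrow> x * inverse x = 1"
    by (simp_all add: inverse_quat_def mult_qcnj qcnj_mult)
  show "x div y = x * inverse y" by (rule divide_quat_def)
  show "inverse (0::quat) = 0" by (simp add: inverse_quat_def)
  have "(norm (x * y))\<^sup>2 = (norm x * norm y)\<^sup>2"
    unfolding power_mult_distrib quat_norm_sq by (simp add: power2_eq_square algebra_simps)
  then show "norm (x * y) = norm x * norm y"
    by (simp add: power2_eq_iff_nonneg)
qed

end

instantiation quat :: euclidean_space
begin

definition Basis_quat :: "quat set"
  where "Basis = {Quat 1 0 0 0, Quat 0 1 0 0, Quat 0 0 1 0, Quat 0 0 0 1}"

instance
proof
  show "(Basis :: quat set) \<noteq> {}" "finite (Basis :: quat set)"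
    by (simp_all add: Basis_quat_def)
  fix x u v :: quat
  show "inner u v = (if u = v then 1 else 0)" if "u \<in> Basis" "v \<in> Basis"
    using that unfolding Basis_quat_def by (elim insertE emptyE; simp add: inner_quat_def)
  show "(\<forall>u\<in>Basis. inner x u = 0) \<longleftrightarrow> x = 0"
    unfolding Basis_quat_def inner_quat_def quat_eq_iff [of x] by simp
qed

end

definition quat_similar :: "quat \<Rightarrow> quat \<Rightarrow> bool"
  where "quat_similar x y \<longleftrightarrow> (\<exists>p. p \<noteq> 0 \<and> y = p * x * inverse p)"

definition imag_units :: "quat set"
  where "imag_units = {I. I * I = -1}"

definition qexp :: "quat \<Rightarrow> real \<Rightarrow> quat"
  where "qexp I \<theta> = of_real (cos \<theta>) + I * of_real (sin \<theta>)"

definition H_star :: "quat monoid"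
  where "H_star = \<lparr>carrier = UNIV - {0}, mult = (*), one = 1\<rparr>"


section \<open>Quaternionic matrices\<close>

definition diag2 :: "'a::zero \<Rightarrow> 'a \<Rightarrow> 'a^2^2"
  where "diag2 a d = vector [vector [a, 0], vector [0, d]]"

definition dieudonne_det :: "quat^2^2 \<Rightarrow> real"
  where "dieudonne_det M =
    (let a = M$1$1; b = M$1$2; c = M$2$1; d = M$2$2
     in if a = 0 then norm (c * b) else norm (a * d - a * c * inverse a * b))"

definition GL2H :: "(quat^2^2) monoid"
  where "GL2H = \<lparr>carrier = {M. invertible M}, mult = (**), one = mat 1\<rparr>"

definition SL2H :: "(quat^2^2) monoid"
  where "SL2H = GL2H\<lparr>carrier := {M \<in> carrier GL2H. dieudonne_det M = 1}\<rparr>"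

definition centralizer :: "('a, 'b) monoid_scheme \<Rightarrow> 'a \<Rightarrow> 'a set"
  where "centralizer G x = {g \<in> carrier G. g \<otimes>\<^bsub>G\<^esub> x = x \<otimes>\<^bsub>G\<^esub> g}"

definition conjugate_in :: "('a, 'b) monoid_scheme \<Rightarrow> 'a \<Rightarrow> 'a \<Rightarrow> bool"
  where "conjugate_in G x y \<longleftrightarrow> (\<exists>g\<in>carrier G. y = g \<otimes>\<^bsub>G\<^esub> x \<otimes>\<^bsub>G\<^esub> inv\<^bsub>G\<^esub> g)"

definition loxodromic :: "quat^2^2 \<Rightarrow> bool"
  where "loxodromic A \<longleftrightarrow> A \<in> carrier SL2H \<and>
    (\<exists>r \<theta> \<phi> I J. r > 1 \<and> \<theta> \<in> {0..pi} \<and> \<phi> \<in> {0..pi} \<and> I \<in> imag_units \<and> J \<in> imag_units \<and>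
      conjugate_in SL2H A (diag2 (of_real r * qexp I \<theta>) (of_real (inverse r) * qexp J \<phi>)))"

definition regular_loxodromic :: "quat^2^2 \<Rightarrow> bool"
  where "regular_loxodromic A \<longleftrightarrow> A \<in> carrier SL2H \<and>
    (\<exists>r \<theta> \<phi> I J. r > 1 \<and> \<theta> \<in> {0<..<pi} \<and> \<phi> \<in> {0<..<pi} \<and> I \<in> imag_units \<and> J \<in> imag_units \<and>
      conjugate_in SL2H A (diag2 (of_real r * qexp I \<theta>) (of_real (inverse r) * qexp J \<phi>)))"


section \<open>Embedded Lie groups\<close>

text \<open>\<open>Ck_on k U f\<close>, for \<open>U\<close> open in a Euclidean space: \<open>f\<close> is \<open>k\<close> times continuously
  differentiable on \<open>U\<close>. Higher derivatives are taken one direction \<open>v\<close> at a time, so that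
  the types do not grow with \<open>k\<close>.\<close>

primrec Ck_on :: "nat \<Rightarrow> 'a::euclidean_space set \<Rightarrow> ('a \<Rightarrow> 'b::euclidean_space) \<Rightarrow> bool" where
  "Ck_on 0 U f \<longleftrightarrow> continuous_on U f"
| "Ck_on (Suc k) U f \<longleftrightarrow> (\<forall>x\<in>U. f differentiable (at x)) \<and>
     (\<forall>v. Ck_on k U (\<lambda>x. frechet_derivative f (at x) v))"

definition smooth_on :: "'a::euclidean_space set \<Rightarrow> ('a \<Rightarrow> 'b::euclidean_space) \<Rightarrow> bool"
  where "smooth_on U f \<longleftrightarrow> (\<forall>k. Ck_on k U f)"

text \<open>Smoothness on a set that need not be open: local extendability to a smooth map of the
  ambient space. On an embedded submanifold this is smoothness in the charts.\<close>

definition smooth_map :: "'a::euclidean_space set \<Rightarrow> ('a \<Rightarrow> 'b::euclidean_space) \<Rightarrow> bool"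
  where "smooth_map S f \<longleftrightarrow>
    (\<forall>x\<in>S. \<exists>U g. open U \<and> x \<in> U \<and> smooth_on U g \<and> (\<forall>y\<in>S \<inter> U. g y = f y))"

definition embedded_submanifold :: "nat \<Rightarrow> 'a::euclidean_space set \<Rightarrow> bool"
  where "embedded_submanifold n S \<longleftrightarrow>
    (\<forall>x\<in>S. \<exists>U V (\<Phi> :: 'a \<Rightarrow> 'a) \<Psi> E. open U \<and> x \<in> U \<and> open V \<and> homeomorphism U V \<Phi> \<Psi> \<and>
       smooth_on U \<Phi> \<and> smooth_on V \<Psi> \<and>
       subspace E \<and> dim E = n \<and> \<Phi> ` (S \<inter> U) = E \<inter> V)"

definition lie_group :: "nat \<Rightarrow> ('a::euclidean_space) monoid \<Rightarrow> bool"
  where "lie_group n G \<longleftrightarrow> group G \<and> embedded_submanifold n (carrier G) \<and>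
    smooth_map (carrier G \<times> carrier G) (\<lambda>(x, y). x \<otimes>\<^bsub>G\<^esub> y) \<and>
    smooth_map (carrier G) (\<lambda>x. inv\<^bsub>G\<^esub> x)"

definition lie_isomorphic :: "('a::euclidean_space) monoid \<Rightarrow> ('b::euclidean_space) monoid \<Rightarrow> bool"
  where "lie_isomorphic G H \<longleftrightarrow>
    (\<exists>h\<in>iso G H. smooth_map (carrier G) h \<and> smooth_map (carrier H) (inv_into (carrier G) h))"

definition pos_reals :: "real monoid"
  where "pos_reals = \<lparr>carrier = {0<..}, mult = (*), one = 1\<rparr>"

definition U1 :: "complex monoid"
  where "U1 = \<lparr>carrier = {z. norm z = 1}, mult = (*), one = 1\<rparr>"

end

theory Submission
  imports Defs
begin

text \<open>
  A matrix \<open>g\<close> with entries \<open>a, b, c, d\<close> commutes with \<open>diag2 lam mu\<close> iff \<open>a\<close> commutes with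
  \<open>lam\<close>, \<open>d\<close> commutes with \<open>mu\<close>, \<open>b\<close> satisfies \<open>lam * b = b * mu\<close> and \<open>c\<close> satisfies
  \<open>mu * c = c * lam\<close>. A nonzero solution of either of the last two equations would make \<open>lam\<close>
  and \<open>mu\<close> similar, so the centralizer is diagonal. Inside \<open>SL2H\<close> the Dieudonne determinant adds
  the condition \<open>norm a * norm d = 1\<close>.

  The elements that commute with a quaternion \<open>x\<close> form a real subspace, closed under products and
  inverses: all of the quaternions if \<open>x\<close> is real, and the span of \<open>1\<close> and \<open>x\<close> otherwise, because
  commuting means that the imaginary parts are parallel vectors. Its dimension is \<open>4\<close> or \<open>2\<close>.
  For \<open>x = of_real r * qexp I \<theta>\<close> with \<open>r * sin \<theta> \<noteq> 0\<close> it is the copy of the complex numbers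
  spanned by \<open>1\<close> and \<open>I\<close>, and polar coordinates there give the description of the centralizer by
  \<open>t, \<sigma>, \<tau>\<close> and the isomorphism with the product of the positive reals and two circles.

  The Lie group structure is obtained for all cases at once. For subspaces \<open>C\<close> and \<open>D\<close>, the
  set of all \<open>diag2 q p\<close> with \<open>q \<in> C\<close>, \<open>p \<in> D\<close> and \<open>norm q * norm p = 1\<close> is an embedded
  submanifold of dimension \<open>dim C + dim D - 1\<close>; an explicit chart
  (\<open>embedded_submanifold_norm_one_diag\<close>) leaves \<open>q\<close> alone, projects \<open>p\<close> centrally to an affine
  hyperplane and uses \<open>norm q * norm p - 1\<close> as the missing coordinate. With the dimensions \<open>2\<close>
  and \<open>4\<close> above this yields \<open>3\<close>, \<open>5\<close> and \<open>7\<close>.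

  It remains to read off \<open>lam\<close> and \<open>mu\<close> from the hypothesis that \<open>diag2 lam mu\<close> is conjugate
  to a normal form \<open>diag2 d1 d2\<close>. The entries of the conjugating matrix intertwine \<open>lam, mu\<close> with
  \<open>d1, d2\<close>, so these are pairwise similar, possibly after a swap
  (\<open>conjugate_diag2_imp_similar\<close>). To use the inverse that occurs in the conjugation in \<open>SL2H\<close> as
  a matrix inverse, one needs that the matrix inverse has determinant \<open>1\<close> as well
  (\<open>dieudonne_det_inverse\<close>).
\<close>

section \<open>Calculus of smooth functions\<close>

text \<open>
  On an open set, derivatives depend only on the values there. This lets the proofs below replace
  \<open>frechet_derivative f (at x)\<close>, which is a choice, by a given derivative.
\<close>

lemma Ck_on_cong:
  assumes "open U" "\<And>x. x \<in> U \<Longrightarrow> f x = g x" "Ck_on k U f"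
  shows "Ck_on k U g"
  using assms(2,3)
proof (induction k arbitrary: f g)
  case 0
  then show ?case by (simp cong: continuous_on_cong)
next
  case (Suc k)
  have der: "(g has_derivative frechet_derivative f (at x)) (at x)" if "x \<in> U" for x
    by (rule has_derivative_transform_within_open[OF _ assms(1) that, of f])
       (use Suc.prems that in \<open>simp_all add: frechet_derivative_works\<close>)
  have eq: "frechet_derivative f (at x) = frechet_derivative g (at x)" if "x \<in> U" for x
    using frechet_derivative_at[OF der[OF that]] .
  show ?case
  proof (simp, intro conjI ballI allI)
    show "g differentiable at x" if "x \<in> U" for x
      using der[OF that] by (auto simp: differentiable_def)
    show "Ck_on k U (\<lambda>x. frechet_derivative g (at x) v)" for v
      using Suc.prems(2) eq Suc.IH[of "\<lambda>x. frechet_derivative f (at x) v"] by simp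
  qed
qed

lemma Ck_on_SucI:
  assumes "open U" "\<And>x. x \<in> U \<Longrightarrow> (f has_derivative f' x) (at x)"
    and "\<And>v. Ck_on k U (\<lambda>x. f' x v)"
  shows "Ck_on (Suc k) U f"
proof (simp, intro conjI ballI allI)
  show "f differentiable at x" if "x \<in> U" for x
    using assms(2)[OF that] by (auto simp: differentiable_def)
  show "Ck_on k U (\<lambda>x. frechet_derivative f (at x) v)" for v
    by (rule Ck_on_cong[OF assms(1) _ assms(3)]) (simp add: frechet_derivative_at[OF assms(2)])
qed

lemma Ck_on_SucE:
  assumes "Ck_on (Suc k) U f"
  obtains f' where "\<forall>x\<in>U. (f has_derivative f' x) (at x)"
    and "\<forall>v. Ck_on k U (\<lambda>x. f' x v)"
proof (rule that)
  show "\<forall>x\<in>U. (f has_derivative frechet_derivative f (at x)) (at x)"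
    using assms by (simp add: frechet_derivative_works)
  show "\<forall>v. Ck_on k U (\<lambda>x. frechet_derivative f (at x) v)"
    using assms by simp
qed

lemma Ck_on_Suc_imp:
  assumes "open U"
  shows "Ck_on (Suc k) U f \<Longrightarrow> Ck_on k U f"
proof (induction k arbitrary: f)
  case 0
  then show ?case
    by (simp add: continuous_at_imp_continuous_on differentiable_imp_continuous_within)
next
  case (Suc k)
  obtain f' where f': "\<forall>x\<in>U. (f has_derivative f' x) (at x)"
    "\<forall>v. Ck_on (Suc k) U (\<lambda>x. f' x v)"
    using Suc.prems by (rule Ck_on_SucE)
  show ?case
    using f' Suc.IH[OF f'(2)[rule_format]]
    by (auto simp: differentiable_def simp del: Ck_on.simps intro!: Ck_on_SucI[OF assms])
qed

lemma Ck_on_const: "open U \<Longrightarrow> Ck_on k U (\<lambda>x. c)"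
proof (induction k arbitrary: c)
  case (Suc k)
  show ?case by (rule Ck_on_SucI[where f' = "\<lambda>x v. 0"]) (simp_all add: Suc)
qed simp

lemma Ck_on_bounded_linear:
  assumes "bounded_linear L" "open U" "Ck_on k U f"
  shows "Ck_on k U (\<lambda>x. L (f x))"
  using assms(3)
proof (induction k arbitrary: f)
  case 0
  then show ?case using assms(1) by (simp add: bounded_linear.continuous_on)
next
  case (Suc k)
  obtain f' where f': "\<forall>x\<in>U. (f has_derivative f' x) (at x)"
    "\<forall>v. Ck_on k U (\<lambda>x. f' x v)"
    using Suc.prems by (rule Ck_on_SucE)
  show ?case
    by (rule Ck_on_SucI[OF assms(2) bounded_linear.has_derivative[OF assms(1) f'(1)[rule_format]] Suc.IH[OF f'(2)[rule_format]]])
qed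

lemma Ck_on_id: "open U \<Longrightarrow> Ck_on k U (\<lambda>x. x)"
proof (cases k)
  case (Suc j)
  assume "open U"
  then show ?thesis
    unfolding Suc by (rule Ck_on_SucI[where f' = "\<lambda>x v. v"]) (simp_all add: Ck_on_const \<open>open U\<close>)
qed simp

lemma Ck_on_add:
  assumes "open U" "Ck_on k U f" "Ck_on k U g"
  shows "Ck_on k U (\<lambda>x. f x + g x)"
  using assms(2,3)
proof (induction k arbitrary: f g)
  case 0
  then show ?case by (simp add: continuous_on_add)
next
  case (Suc k)
  obtain f' where f': "\<forall>x\<in>U. (f has_derivative f' x) (at x)"
    "\<forall>v. Ck_on k U (\<lambda>x. f' x v)"
    using Suc.prems(1) by (rule Ck_on_SucE)
  obtain g' where g': "\<forall>x\<in>U. (g has_derivative g' x) (at x)"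
    "\<forall>v. Ck_on k U (\<lambda>x. g' x v)"
    using Suc.prems(2) by (rule Ck_on_SucE)
  show ?case
    by (rule Ck_on_SucI[OF assms(1) has_derivative_add[OF f'(1)[rule_format] g'(1)[rule_format]] Suc.IH[OF f'(2)[rule_format] g'(2)[rule_format]]])
qed

text \<open>
  The derivative of \<open>B (f x) (g x)\<close> is again a sum of terms of this form, so all products are
  covered by one induction on \<open>k\<close>.
\<close>

lemma Ck_on_bilinear:
  assumes B: "bounded_bilinear B" and "open U" "Ck_on k U f" "Ck_on k U g"
  shows "Ck_on k U (\<lambda>x. B (f x) (g x))"
  using assms(3,4)
proof (induction k arbitrary: f g)
  case 0
  then show ?case using bounded_bilinear.continuous_on[OF B] by simp
next
  case (Suc k)
  obtain f' where f': "\<forall>x\<in>U. (f has_derivative f' x) (at x)"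
    "\<forall>v. Ck_on k U (\<lambda>x. f' x v)"
    using Suc.prems(1) by (rule Ck_on_SucE)
  obtain g' where g': "\<forall>x\<in>U. (g has_derivative g' x) (at x)"
    "\<forall>v. Ck_on k U (\<lambda>x. g' x v)"
    using Suc.prems(2) by (rule Ck_on_SucE)
  show ?case
    by (rule Ck_on_SucI[OF assms(2) bounded_bilinear.FDERIV[OF B f'(1)[rule_format] g'(1)[rule_format]]
          Ck_on_add[OF assms(2) Suc.IH[OF Ck_on_Suc_imp[OF assms(2) Suc.prems(1)] g'(2)[rule_format]]
            Suc.IH[OF f'(2)[rule_format] Ck_on_Suc_imp[OF assms(2) Suc.prems(2)]]]])
qed

lemmas Ck_on_mult = Ck_on_bilinear[OF bounded_bilinear_mult]

text \<open>
  The derivative \<open>- (inverse (f x) * f' x v * inverse (f x))\<close> is a product of functions that are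
  \<open>k\<close> times continuously differentiable by the induction hypothesis. The same argument handles
  square roots. Charts and group operations below are all built from linear maps, products,
  inverses and square roots.
\<close>

lemma Ck_on_inverse:
  fixes f :: "'a::euclidean_space \<Rightarrow> real"
  assumes "open U" "\<And>x. x \<in> U \<Longrightarrow> f x \<noteq> 0" "Ck_on k U f"
  shows "Ck_on k U (\<lambda>x. inverse (f x))"
  using assms(3)
proof (induction k)
  case 0
  then show ?case using assms(2) by (simp add: continuous_on_inverse)
next
  case (Suc k)
  obtain f' where f': "\<forall>x\<in>U. (f has_derivative f' x) (at x)"
    "\<forall>v. Ck_on k U (\<lambda>x. f' x v)"
    using Suc.prems by (rule Ck_on_SucE)
  have IH: "Ck_on k U (\<lambda>x. inverse (f x))"
    by (rule Suc.IH[OF Ck_on_Suc_imp[OF assms(1) Suc.prems]])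
  show ?case
    by (rule Ck_on_SucI[OF assms(1) Deriv.has_derivative_inverse[OF assms(2) f'(1)[rule_format]]
          Ck_on_bounded_linear[OF bounded_linear_minus[OF bounded_linear_ident] assms(1)
            Ck_on_mult[OF assms(1) Ck_on_mult[OF assms(1) IH f'(2)[rule_format]] IH]]])
qed

lemma Ck_on_sqrt:
  assumes "open U" "\<And>x. x \<in> U \<Longrightarrow> f x > 0" "Ck_on k U f"
  shows "Ck_on k U (\<lambda>x. sqrt (f x))"
  using assms(3)
proof (induction k)
  case 0
  then show ?case by (simp add: continuous_on_real_sqrt)
next
  case (Suc k)
  obtain f' where f': "\<forall>x\<in>U. (f has_derivative f' x) (at x)"
    "\<forall>v. Ck_on k U (\<lambda>x. f' x v)"
    using Suc.prems by (rule Ck_on_SucE)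
  have IH: "Ck_on k U (\<lambda>x. sqrt (f x))"
    by (rule Suc.IH[OF Ck_on_Suc_imp[OF assms(1) Suc.prems]])
  have inv: "Ck_on k U (\<lambda>x. inverse (2 * sqrt (f x)))"
    using assms(2)
    by (intro Ck_on_inverse Ck_on_mult[OF assms(1) Ck_on_const[OF assms(1)] IH] assms(1))
       (metis less_irrefl mult_eq_0_iff real_sqrt_gt_zero zero_neq_numeral)
  show ?case
  proof (rule Ck_on_SucI[OF assms(1), where f' = "\<lambda>x v. f' x v * inverse (2 * sqrt (f x))"])
    show "((\<lambda>x. sqrt (f x)) has_derivative (\<lambda>v. f' x v * inverse (2 * sqrt (f x)))) (at x)"
      if "x \<in> U" for x
      using assms(2)[OF that] f'(1) that
      by (auto intro!: derivative_eq_intros simp: field_simps)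
    show "Ck_on k U (\<lambda>x. f' x v * inverse (2 * sqrt (f x)))" for v
      by (rule Ck_on_mult[OF assms(1) f'(2)[rule_format] inv])
  qed
qed

lemma smooth_on_const: "open U \<Longrightarrow> smooth_on U (\<lambda>x. c)"
  by (simp add: smooth_on_def Ck_on_const)

lemma smooth_on_bounded_linear:
  "bounded_linear L \<Longrightarrow> open U \<Longrightarrow> smooth_on U f \<Longrightarrow> smooth_on U (\<lambda>x. L (f x))"
  by (simp add: smooth_on_def Ck_on_bounded_linear)

lemma smooth_on_linear: "bounded_linear L \<Longrightarrow> open U \<Longrightarrow> smooth_on U L"
  by (simp add: smooth_on_def Ck_on_bounded_linear[where f = "\<lambda>x. x"] Ck_on_id)

lemma smooth_on_add:
  "open U \<Longrightarrow> smooth_on U f \<Longrightarrow> smooth_on U g \<Longrightarrow> smooth_on U (\<lambda>x. f x + g x)"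
  by (simp add: smooth_on_def Ck_on_add)

lemma smooth_on_bilinear:
  "bounded_bilinear B \<Longrightarrow> open U \<Longrightarrow> smooth_on U f \<Longrightarrow> smooth_on U g \<Longrightarrow>
    smooth_on U (\<lambda>x. B (f x) (g x))"
  by (simp add: smooth_on_def Ck_on_bilinear)

lemmas smooth_on_mult = smooth_on_bilinear[OF bounded_bilinear_mult]
lemmas smooth_on_scaleR = smooth_on_bilinear[OF bounded_bilinear_scaleR]
lemmas smooth_on_inner = smooth_on_bilinear[OF bounded_bilinear_inner]

lemma smooth_on_diff:
  assumes "open U" "smooth_on U f" "smooth_on U g"
  shows "smooth_on U (\<lambda>x. f x - g x)"
  using smooth_on_add[OF assms(1,2) smooth_on_bounded_linear[OF _ assms(1,3), of uminus]]
  by (simp add: bounded_linear_minus bounded_linear_ident)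

lemma smooth_on_inverse_real:
  fixes f :: "'a::euclidean_space \<Rightarrow> real"
  shows "open U \<Longrightarrow> smooth_on U f \<Longrightarrow> (\<And>x. x \<in> U \<Longrightarrow> f x \<noteq> 0) \<Longrightarrow> smooth_on U (\<lambda>x. inverse (f x))"
  by (simp add: smooth_on_def Ck_on_inverse)

lemma smooth_on_norm:
  fixes f :: "'a::euclidean_space \<Rightarrow> 'b::euclidean_space"
  assumes "open U" "smooth_on U f" "\<And>x. x \<in> U \<Longrightarrow> f x \<noteq> 0"
  shows "smooth_on U (\<lambda>x. norm (f x))"
proof -
  have "smooth_on U (\<lambda>x. f x \<bullet> f x)"
    by (rule smooth_on_inner[OF assms(1,2,2)])
  then have "smooth_on U (\<lambda>x. sqrt (f x \<bullet> f x))"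
    using assms(1,3) by (simp add: smooth_on_def Ck_on_sqrt)
  then show ?thesis by (simp add: norm_eq_sqrt_inner)
qed

lemma smooth_on_Pair:
  assumes "open U" "smooth_on U f" "smooth_on U g"
  shows "smooth_on U (\<lambda>x. (f x, g x))"
proof -
  have "smooth_on U (\<lambda>x. (f x, 0) + (0, g x))"
    using smooth_on_add[OF assms(1) smooth_on_bounded_linear[OF _ assms(1,2), of "\<lambda>x. (x, 0)"]
        smooth_on_bounded_linear[OF _ assms(1,3), of "\<lambda>x. (0, x)"]]
    by (simp add: bounded_linear_Pair bounded_linear_zero bounded_linear_ident)
  then show ?thesis by simp
qed

lemma smooth_on_continuous: "smooth_on U f \<Longrightarrow> continuous_on U f"
  unfolding smooth_on_def by (metis Ck_on.simps(1))

lemma smooth_mapI: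
  assumes "open U" "S \<subseteq> U" "smooth_on U g" "\<And>x. x \<in> S \<Longrightarrow> g x = f x"
  shows "smooth_map S f"
  unfolding smooth_map_def
proof
  fix x assume "x \<in> S"
  then show "\<exists>U g. open U \<and> x \<in> U \<and> smooth_on U g \<and> (\<forall>y\<in>S \<inter> U. g y = f y)"
    by (intro exI[of _ U] exI[of _ g]) (use assms in auto)
qed

lemmas smooth_on_intros = smooth_on_const smooth_on_add smooth_on_diff smooth_on_scaleR
  smooth_on_inner smooth_on_mult smooth_on_inverse_real smooth_on_norm

section \<open>Quaternions and diagonal matrices\<close>

lemma qcnj_bounded_linear: "bounded_linear qcnj"
  by (simp add: linear_conv_bounded_linear[symmetric] linear_iff quat_eq_iff)

lemma smooth_on_inverse_quat:
  fixes f :: "'a::euclidean_space \<Rightarrow> quat"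
  assumes "open U" "smooth_on U f" "\<And>x. x \<in> U \<Longrightarrow> f x \<noteq> 0"
  shows "smooth_on U (\<lambda>x. inverse (f x))"
proof -
  have "smooth_on U (\<lambda>x. inverse (f x \<bullet> f x) *\<^sub>R qcnj (f x))"
    using assms
    by (intro smooth_on_intros smooth_on_bounded_linear[OF qcnj_bounded_linear]) auto
  then show ?thesis
    by (simp add: inverse_quat_def dot_square_norm)
qed

lemma quat_of_real_components [simp]:
  "qre (of_real r) = r" "qi (of_real r) = 0" "qj (of_real r) = 0" "qk (of_real r) = 0"
  by (simp_all add: of_real_def)

lemma quat_Reals_iff: "x \<in> \<real> \<longleftrightarrow> qi x = 0 \<and> qj x = 0 \<and> qk x = 0" for x :: quat
proof
  assume "qi x = 0 \<and> qj x = 0 \<and> qk x = 0"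
  then have "x = of_real (qre x)" by (simp add: quat_eq_iff)
  then show "x \<in> \<real>" by (metis Reals_of_real)
qed (auto elim!: Reals_cases)

lemma mat2_eq_iff:
  "M = N \<longleftrightarrow> M$1$1 = N$1$1 \<and> M$1$2 = N$1$2 \<and> M$2$1 = N$2$1 \<and> M$2$2 = N$2$2"
  for M N :: "'a^2^2"
  by (auto simp: vec_eq_iff forall_2)

lemma diag2_nth [simp]:
  "diag2 a d $ 1 $ 1 = a" "diag2 a d $ 1 $ 2 = 0" "diag2 a d $ 2 $ 1 = 0" "diag2 a d $ 2 $ 2 = d"
  by (simp_all add: diag2_def)

lemma diag2_eq_iff [simp]: "diag2 a d = diag2 a' d' \<longleftrightarrow> a = a' \<and> d = d'"
  by (auto simp: mat2_eq_iff)

lemma matrix_mult_nth2: "(M ** N) $ i $ j = M$i$1 * N$1$j + M$i$2 * N$2$j"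
  for M N :: "'a::semiring_1^2^2"
  by (simp add: matrix_matrix_mult_def sum_2)

lemma diag2_mult [simp]: "diag2 a d ** diag2 a' d' = diag2 (a * a') (d * d')"
  for a d :: "'a::semiring_1"
  by (simp add: mat2_eq_iff matrix_mult_nth2)

lemma mat_1_eq_diag2: "mat 1 = diag2 (1::'a::semiring_1) 1"
  by (simp add: mat2_eq_iff mat_def)

lemma entry_bounded_linear: "bounded_linear (\<lambda>M :: quat^2^2. M $ i $ j)"
  by (simp add: linear_conv_bounded_linear[symmetric] linear_iff)

lemma smooth_on_diag2:
  fixes f g :: "'a::euclidean_space \<Rightarrow> quat"
  assumes "open U" "smooth_on U f" "smooth_on U g"
  shows "smooth_on U (\<lambda>x. diag2 (f x) (g x))"
proof -
  have "bounded_linear (\<lambda>q :: quat. diag2 q 0)" "bounded_linear (\<lambda>q :: quat. diag2 0 q)"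
    by (simp_all add: linear_conv_bounded_linear[symmetric] linear_iff mat2_eq_iff)
  then have "smooth_on U (\<lambda>x. diag2 (f x) 0 + diag2 0 (g x))"
    using smooth_on_add[OF assms(1) smooth_on_bounded_linear[OF _ assms(1,2)]
        smooth_on_bounded_linear[OF _ assms(1,3)]] by blast
  moreover have "diag2 (f x) 0 + diag2 0 (g x) = diag2 (f x) (g x)" for x
    by (simp add: mat2_eq_iff)
  ultimately show ?thesis by simp
qed

lemma dieudonne_det_diag2 [simp]: "dieudonne_det (diag2 q p) = norm q * norm p"
  by (simp add: dieudonne_det_def norm_mult)

lemma invertible_diag2_iff: "invertible (diag2 q p) \<longleftrightarrow> q \<noteq> 0 \<and> p \<noteq> 0" for q p :: quat
proof
  assume "invertible (diag2 q p)"
  then obtain N where "diag2 q p ** N = mat 1" by (auto simp: invertible_def)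
  then show "q \<noteq> 0 \<and> p \<noteq> 0"
    by (auto simp: mat2_eq_iff matrix_mult_nth2 mat_1_eq_diag2)
next
  assume "q \<noteq> 0 \<and> p \<noteq> 0"
  then have "diag2 q p ** diag2 (inverse q) (inverse p) = mat 1"
    "diag2 (inverse q) (inverse p) ** diag2 q p = mat 1"
    by (simp_all add: mat_1_eq_diag2)
  then show "invertible (diag2 q p)" unfolding invertible_def by blast
qed

section \<open>Centralizers in the quaternions\<close>

text \<open>
  Keeping \<open>0\<close> turns the centralizer in the multiplicative group into a linear subspace.
\<close>

definition commutant :: "quat \<Rightarrow> quat set"
  where "commutant x = {q. q * x = x * q}"

lemma subspace_commutant: "subspace (commutant x)"
  by (auto simp: subspace_def commutant_def algebra_simps)

lemma commutant_1: "1 \<in> commutant x"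
  by (simp add: commutant_def)

lemma commutant_mult: "p \<in> commutant x \<Longrightarrow> q \<in> commutant x \<Longrightarrow> p * q \<in> commutant x"
  unfolding commutant_def by (simp add: mult.assoc) (simp add: mult.assoc[symmetric])

lemma commutant_inverse:
  assumes "q \<in> commutant x"
  shows "inverse q \<in> commutant x"
proof (cases "q = 0")
  case False
  then have "inverse q * x = inverse q * (x * q) * inverse q"
    by (simp add: mult.assoc)
  also have "\<dots> = inverse q * (q * x) * inverse q"
    using assms by (simp add: commutant_def)
  also have "\<dots> = x * inverse q"
    using False by (simp add: mult.assoc[symmetric])
  finally show ?thesis by (simp add: commutant_def)
qed (simp add: commutant_def)

lemma commutant_real: "x \<in> \<real> \<Longrightarrow> commutant x = UNIV"
  by (auto simp: commutant_def of_real_def elim!: Reals_cases)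

text \<open>
  Commuting with \<open>x\<close> means that the cross product of the imaginary parts vanishes, so the
  imaginary part of \<open>q\<close> is a multiple \<open>b\<close> of that of \<open>x\<close>.
\<close>

lemma commutant_nonreal:
  assumes "x \<notin> \<real>"
  shows "commutant x = {of_real a + b *\<^sub>R x | a b. True}"
proof -
  define n where "n = (qi x)\<^sup>2 + (qj x)\<^sup>2 + (qk x)\<^sup>2"
  have n: "n \<noteq> 0"
    using assms by (auto simp: n_def quat_Reals_iff add_nonneg_eq_0_iff)
  have "\<exists>a b. q = of_real a + b *\<^sub>R x" if "q * x = x * q" for q
  proof (intro exI)
    define b where "b = (qi q * qi x + qj q * qj x + qk q * qk x) / n"
    have c: "qj q * qk x = qk q * qj x" "qk q * qi x = qi q * qk x" "qi q * qj x = qj q * qi x"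
      using that by (simp_all add: quat_eq_iff algebra_simps)
    \<comment> \<open>The components of \<open>(w \<bullet> w) v - (v \<bullet> w) w = w \<times> (v \<times> w)\<close> for the imaginary parts \<open>v\<close> of \<open>q\<close>
       and \<open>w\<close> of \<open>x\<close>.\<close>
    have "qi q * n - (qi q * qi x + qj q * qj x + qk q * qk x) * qi x =
        (qi q * qj x - qj q * qi x) * qj x - (qk q * qi x - qi q * qk x) * qk x"
      "qj q * n - (qi q * qi x + qj q * qj x + qk q * qk x) * qj x =
        (qj q * qk x - qk q * qj x) * qk x - (qi q * qj x - qj q * qi x) * qi x"
      "qk q * n - (qi q * qi x + qj q * qj x + qk q * qk x) * qk x =
        (qk q * qi x - qi q * qk x) * qi x - (qj q * qk x - qk q * qj x) * qj x"
      by (simp_all add: n_def power2_eq_square algebra_simps)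
    then have "qi q * n = (qi q * qi x + qj q * qj x + qk q * qk x) * qi x"
      "qj q * n = (qi q * qi x + qj q * qj x + qk q * qk x) * qj x"
      "qk q * n = (qi q * qi x + qj q * qj x + qk q * qk x) * qk x"
      unfolding c by simp_all
    then have "qi q = b * qi x" "qj q = b * qj x" "qk q = b * qk x"
      using n by (simp_all add: b_def field_simps)
    then show "q = of_real (qre q - b * qre x) + b *\<^sub>R x"
      by (simp add: quat_eq_iff)
  qed
  then show ?thesis
    by (auto simp: commutant_def quat_eq_iff algebra_simps)
qed

lemma dim_commutant_real: "x \<in> \<real> \<Longrightarrow> dim (commutant x) = 4"
  by (simp add: commutant_real) (simp add: Basis_quat_def)

lemma dim_commutant_nonreal:
  assumes "x \<notin> \<real>"
  shows "dim (commutant x) = 2"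
proof -
  have "commutant x = span {1, x}"
  proof
    show "span {1, x} \<subseteq> commutant x"
      by (intro span_minimal subspace_commutant) (auto simp: commutant_def)
    show "commutant x \<subseteq> span {1, x}"
      by (auto simp: commutant_nonreal[OF assms] of_real_def intro!: span_add span_scale intro: span_base)
  qed
  moreover have "x \<noteq> k *\<^sub>R 1" for k
    using assms by (auto simp: quat_Reals_iff)
  then have "independent {x, 1}"
    by (simp add: independent_insert span_singleton image_iff)
  then have "independent {1, x}"
    by (simp add: insert_commute)
  moreover have "x \<noteq> 1" using assms by auto
  ultimately show ?thesis
    by (simp add: dim_span dim_eq_card_independent)
qed

section \<open>The centralizer as an embedded Lie group\<close>

text \<open>
  For the commutants \<open>C\<close> and \<open>D\<close> of two quaternions that are not similar, this is the
  centralizer of their diagonal matrix in \<open>SL2H\<close>.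
\<close>

definition norm_one_diag :: "quat set \<Rightarrow> quat set \<Rightarrow> (quat^2^2) set"
  where "norm_one_diag C D = {diag2 q p | q p. q \<in> C \<and> p \<in> D \<and> norm q * norm p = 1}"

lemma norm_one_diag_iff:
  "M \<in> norm_one_diag C D \<longleftrightarrow> M$1$1 \<in> C \<and> M$2$2 \<in> D \<and> M$1$2 = 0 \<and> M$2$1 = 0 \<and>
    norm (M$1$1) * norm (M$2$2) = 1"
proof
  assume *: "M$1$1 \<in> C \<and> M$2$2 \<in> D \<and> M$1$2 = 0 \<and> M$2$1 = 0 \<and> norm (M$1$1) * norm (M$2$2) = 1"
  then have "M = diag2 (M$1$1) (M$2$2)" by (simp add: mat2_eq_iff)
  with * show "M \<in> norm_one_diag C D" unfolding norm_one_diag_def by blast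
qed (auto simp: norm_one_diag_def)

text \<open>
  The linear model of the chart below: requiring the second entry to be orthogonal to a nonzero
  vector of \<open>D\<close> costs exactly one dimension.
\<close>

lemma dim_slice:
  fixes C D :: "quat set"
  assumes C: "subspace C" and D: "subspace D" and e: "e \<in> D" "e \<noteq> 0"
  defines "E \<equiv> {M :: quat^2^2. M$1$1 \<in> C \<and> M$2$2 \<in> D \<and> M$2$2 \<bullet> e = 0 \<and> M$1$2 = 0 \<and> M$2$1 = 0}"
  shows "subspace E" "dim E = dim C + dim D - 1"
proof -
  show "subspace E"
    using C D by (auto simp: E_def subspace_def inner_add_left)
  define D' where "D' = {y \<in> D. \<forall>x\<in>span {e}. orthogonal x y}"
  have D'_eq: "D' = {y \<in> D. y \<bullet> e = 0}"
    by (auto simp: D'_def orthogonal_def span_singleton inner_commute)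
  have "span {e} \<subseteq> D" using D e by (simp add: span_minimal)
  then have "dim D' + dim (span {e}) = dim D"
    unfolding D'_def by (intro dim_subspace_orthogonal_to_vectors D) auto
  moreover have "dim {e} = 1"
    using e(2) by (simp add: dim_eq_card_independent)
  ultimately have "dim D' = dim D - 1" "dim D \<ge> 1" by auto
  moreover have "subspace D'"
    using D by (auto simp: D'_eq subspace_def inner_add_left)
  ultimately have "dim (C \<times> D') = dim C + dim D - 1"
    by (simp add: dim_Times C)
  moreover have "E = (\<lambda>(q, p). diag2 q p) ` (C \<times> D')"
    unfolding E_def D'_eq by (force simp: mat2_eq_iff image_iff)
  moreover have "linear (\<lambda>(q :: quat, p :: quat). diag2 q p)"
    by (auto simp: linear_iff mat2_eq_iff)
  then have "dim ((\<lambda>(q :: quat, p :: quat). diag2 q p) ` (C \<times> D')) = dim (C \<times> D')"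
    by (rule dim_image_eq) (auto simp: inj_on_def)
  ultimately show "dim E = dim C + dim D - 1" by simp
qed

text \<open>
  Near a point with second entry \<open>p0\<close>, let \<open>e = p0 / norm p0\<close>. The chart maps \<open>(q, p)\<close> to
  \<open>(q, p / (p \<bullet> e) - e + (norm q * norm p - 1) e)\<close>. Here \<open>p / (p \<bullet> e) - e\<close> is orthogonal to \<open>e\<close>
  and determines the ray through \<open>p\<close>, while the coefficient of \<open>e\<close> determines the norm of \<open>p\<close>
  and vanishes exactly on the submanifold. Since \<open>e \<in> D\<close>, the chart respects \<open>D\<close>, so the image
  of the submanifold is an open part of a linear subspace.
\<close>

lemma embedded_submanifold_norm_one_diag:
  assumes C: "subspace C" and D: "subspace D"
  shows "embedded_submanifold (dim C + dim D - 1) (norm_one_diag C D)"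
  unfolding embedded_submanifold_def
proof
  fix X assume X: "X \<in> norm_one_diag C D"
  define p0 where "p0 = X$2$2"
  have p0: "p0 \<in> D" "p0 \<noteq> 0" "X$1$1 \<noteq> 0"
    using X by (auto simp: norm_one_diag_iff p0_def)
  define e where "e = inverse (norm p0) *\<^sub>R p0"
  have e: "e \<in> D" "e \<bullet> e = 1" "e \<noteq> 0" "p0 \<bullet> e > 0"
    using p0 D by (auto simp: e_def subspace_def dot_square_norm power2_eq_square)
  define \<phi> where "\<phi> = (\<lambda>(q :: quat) (p :: quat). inverse (p \<bullet> e) *\<^sub>R p + (norm q * norm p - 2) *\<^sub>R e)"
  define w where "w = (\<lambda>y :: quat. y + (1 - y \<bullet> e) *\<^sub>R e)"
  \<comment> \<open>\<open>w y\<close> spans the ray of \<open>p\<close> and is normalized by \<open>w y \<bullet> e = 1\<close>; \<open>\<psi>\<close> rescales it so that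
     \<open>norm q * norm p = y \<bullet> e + 1\<close>.\<close>
  define \<psi> where "\<psi> = (\<lambda>(q :: quat) (y :: quat). ((y \<bullet> e + 1) * inverse (norm q * norm (w y))) *\<^sub>R w y)"
  \<comment> \<open>The chart lives on an open set of matrices, so it also carries along the off-diagonal entries.\<close>
  define \<Phi> where "\<Phi> = (\<lambda>M :: quat^2^2. M + diag2 0 (\<phi> (M$1$1) (M$2$2) - M$2$2))"
  define \<Psi> where "\<Psi> = (\<lambda>M :: quat^2^2. M + diag2 0 (\<psi> (M$1$1) (M$2$2) - M$2$2))"
  define U where "U = {M :: quat^2^2. M$1$1 \<noteq> 0 \<and> M$2$2 \<bullet> e > 0}"
  define V where "V = {M :: quat^2^2. M$1$1 \<noteq> 0 \<and> M$2$2 \<bullet> e > -1}"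
  define E where "E = {M :: quat^2^2. M$1$1 \<in> C \<and> M$2$2 \<in> D \<and> M$2$2 \<bullet> e = 0 \<and> M$1$2 = 0 \<and> M$2$1 = 0}"

  have w_e: "w y \<bullet> e = 1" for y
    using e(2) by (simp add: w_def inner_add_left)
  then have w_nz: "w y \<noteq> 0" for y
    by (metis inner_zero_left zero_neq_one)
  have \<phi>_e: "\<phi> q p \<bullet> e = norm q * norm p - 1" if "p \<bullet> e > 0" for q p
    using that e(2) by (simp add: \<phi>_def inner_add_left)
  have w_\<phi>: "w (\<phi> q p) = inverse (p \<bullet> e) *\<^sub>R p" if "p \<bullet> e > 0" for q p
    unfolding w_def \<phi>_e[OF that] by (simp add: \<phi>_def algebra_simps flip: scaleR_add_left)
  have \<psi>_e: "\<psi> q y \<bullet> e = (y \<bullet> e + 1) * inverse (norm q * norm (w y))" for q y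
    by (simp add: \<psi>_def w_e)
  have \<psi>_e_pos: "\<psi> q y \<bullet> e > 0" if "q \<noteq> 0" "y \<bullet> e > -1" for q y
    unfolding \<psi>_e using that w_nz[of y] by simp
  have norm_\<psi>: "norm q * norm (\<psi> q y) = y \<bullet> e + 1" if "q \<noteq> 0" "y \<bullet> e > -1" for q y
    using that w_nz[of y] by (simp add: \<psi>_def field_simps)
  have \<psi>_\<phi>: "\<psi> q (\<phi> q p) = p" if "q \<noteq> 0" "p \<bullet> e > 0" for q p
  proof -
    have "p \<noteq> 0" using that by auto
    then show ?thesis
      unfolding \<psi>_def w_\<phi>[OF that(2)] \<phi>_e[OF that(2)]
      using that by (simp add: field_simps)
  qed
  have \<phi>_\<psi>: "\<phi> q (\<psi> q y) = y" if "q \<noteq> 0" "y \<bullet> e > -1" for q y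
  proof -
    have "\<psi> q y = (\<psi> q y \<bullet> e) *\<^sub>R w y"
      unfolding \<psi>_e by (simp add: \<psi>_def)
    then have "inverse (\<psi> q y \<bullet> e) *\<^sub>R \<psi> q y =
        inverse (\<psi> q y \<bullet> e) *\<^sub>R ((\<psi> q y \<bullet> e) *\<^sub>R w y)"
      by (rule arg_cong[where f = "\<lambda>v. inverse (\<psi> q y \<bullet> e) *\<^sub>R v"])
    then have "inverse (\<psi> q y \<bullet> e) *\<^sub>R \<psi> q y = w y"
      using \<psi>_e_pos[OF that] by simp
    then show ?thesis
      unfolding \<phi>_def norm_\<psi>[OF that] by (simp add: w_def algebra_simps)
  qed

  have \<Phi>_nth: "\<Phi> M $1$1 = M$1$1" "\<Phi> M $1$2 = M$1$2" "\<Phi> M $2$1 = M$2$1" "\<Phi> M $2$2 = \<phi> (M$1$1) (M$2$2)" for M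
    by (simp_all add: \<Phi>_def)
  have \<Psi>_nth: "\<Psi> M $1$1 = M$1$1" "\<Psi> M $1$2 = M$1$2" "\<Psi> M $2$1 = M$2$1" "\<Psi> M $2$2 = \<psi> (M$1$1) (M$2$2)" for M
    by (simp_all add: \<Psi>_def)
  have \<Phi>_V: "\<Phi> M \<in> V" and \<Psi>_\<Phi>: "\<Psi> (\<Phi> M) = M" if "M \<in> U" for M
  proof -
    have "M$2$2 \<noteq> 0" using that by (auto simp: U_def)
    then show "\<Phi> M \<in> V" using that by (simp add: U_def V_def \<Phi>_nth \<phi>_e)
    show "\<Psi> (\<Phi> M) = M"
      using that by (simp add: U_def mat2_eq_iff \<Phi>_nth \<Psi>_nth \<psi>_\<phi>)
  qed
  have \<Psi>_U: "\<Psi> M \<in> U" and \<Phi>_\<Psi>: "\<Phi> (\<Psi> M) = M" if "M \<in> V" for M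
    using that by (auto simp: U_def V_def mat2_eq_iff \<Phi>_nth \<Psi>_nth \<psi>_e_pos \<phi>_\<psi>)

  have "open U" "open V"
    unfolding U_def V_def
    by (intro open_Collect_conj open_Collect_neq open_Collect_less continuous_intros)+
  have entry: "smooth_on U (\<lambda>M :: quat^2^2. M $ i $ j)" if "open U" for i j U
    by (rule smooth_on_linear[OF entry_bounded_linear that])
  have ident: "smooth_on U (\<lambda>M :: quat^2^2. M)" if "open U" for U
    by (rule smooth_on_linear[OF bounded_linear_ident that])
  have smooth_\<Phi>: "smooth_on U \<Phi>"
    unfolding \<Phi>_def \<phi>_def using \<open>open U\<close>
    by (intro smooth_on_intros smooth_on_diag2 ident entry) (auto simp: U_def)
  have smooth_\<Psi>: "smooth_on V \<Psi>"
    unfolding \<Psi>_def \<psi>_def w_def using \<open>open V\<close>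
    by (intro smooth_on_intros smooth_on_diag2 ident entry)
       (use w_nz in \<open>auto simp: V_def w_def\<close>)

  have "homeomorphism U V \<Phi> \<Psi>"
    unfolding homeomorphism_def
  proof (intro conjI ballI equalityI subsetI)
    show "y \<in> \<Phi> ` U" if "y \<in> V" for y
      using \<Phi>_\<Psi>[OF that] \<Psi>_U[OF that] by (metis imageI)
    show "x \<in> \<Psi> ` V" if "x \<in> U" for x
      using \<Psi>_\<Phi>[OF that] \<Phi>_V[OF that] by (metis imageI)
  qed (auto simp: \<Phi>_V \<Psi>_U \<Psi>_\<Phi> \<Phi>_\<Psi> smooth_on_continuous smooth_\<Phi> smooth_\<Psi>)
  moreover have "\<Phi> ` (norm_one_diag C D \<inter> U) = E \<inter> V"
  proof (intro equalityI subsetI)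
    fix N assume "N \<in> \<Phi> ` (norm_one_diag C D \<inter> U)"
    then obtain M where M: "M \<in> norm_one_diag C D" "M \<in> U" "N = \<Phi> M" by auto
    have "\<phi> (M$1$1) (M$2$2) \<in> D"
      unfolding \<phi>_def using D e(1) M(1)
      by (intro subspace_add subspace_scale) (auto simp: norm_one_diag_iff)
    with M \<Phi>_V[OF M(2)] show "N \<in> E \<inter> V"
      by (auto simp: E_def \<Phi>_nth norm_one_diag_iff U_def \<phi>_e)
  next
    fix N assume N: "N \<in> E \<inter> V"
    then have "\<psi> (N$1$1) (N$2$2) \<in> D"
      unfolding \<psi>_def w_def using D e(1)
      by (intro subspace_add subspace_scale) (auto simp: E_def)
    with N have "\<Psi> N \<in> norm_one_diag C D"
      by (auto simp: E_def V_def norm_one_diag_iff \<Psi>_nth norm_\<psi>)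
    with N show "N \<in> \<Phi> ` (norm_one_diag C D \<inter> U)"
      using \<Psi>_U \<Phi>_\<Psi> by (metis IntD2 IntI imageI)
  qed
  moreover have "X \<in> U" using p0 e(4) by (simp add: U_def p0_def)
  moreover note \<open>open U\<close> \<open>open V\<close> smooth_\<Phi> smooth_\<Psi> dim_slice[OF C D e(1,3), folded E_def]
  ultimately have chart: "open U \<and> X \<in> U \<and> open V \<and> homeomorphism U V \<Phi> \<Psi> \<and>
      smooth_on U \<Phi> \<and> smooth_on V \<Psi> \<and> subspace E \<and> dim E = dim C + dim D - 1 \<and>
      \<Phi> ` (norm_one_diag C D \<inter> U) = E \<inter> V"
    by blast
  show "\<exists>U V (\<Phi> :: quat^2^2 \<Rightarrow> quat^2^2) \<Psi> E. open U \<and> X \<in> U \<and> open V \<and> homeomorphism U V \<Phi> \<Psi> \<and>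
      smooth_on U \<Phi> \<and> smooth_on V \<Psi> \<and> subspace E \<and> dim E = dim C + dim D - 1 \<and>
      \<Phi> ` (norm_one_diag C D \<inter> U) = E \<inter> V"
    by (rule exI[of _ U], rule exI[of _ V], rule exI[of _ \<Phi>], rule exI[of _ \<Psi>],
        rule exI[of _ E], rule chart)
qed

text \<open>
  The operation \<open>inv\<close> of \<open>Z\<close> is defined by its carrier; it has to be identified with the
  entrywise inverse before its smoothness can be discussed.
\<close>

lemma norm_one_diag_group:
  assumes "carrier Z = norm_one_diag (commutant x) (commutant y)"
    and "mult Z = (**)" and "one Z = mat 1"
  shows "group Z" and "M \<in> carrier Z \<Longrightarrow> inv\<^bsub>Z\<^esub> M = diag2 (inverse (M$1$1)) (inverse (M$2$2))"
proof -
  have norm_nz: "M$1$1 \<noteq> 0" "M$2$2 \<noteq> 0" if "M \<in> carrier Z" for M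
    using that unfolding assms(1) by (auto simp: norm_one_diag_iff)
  have inverse_closed: "diag2 (inverse (M$1$1)) (inverse (M$2$2)) \<in> carrier Z"
    and inverse_left: "diag2 (inverse (M$1$1)) (inverse (M$2$2)) ** M = mat 1" if "M \<in> carrier Z" for M
    using that norm_nz[OF that] unfolding assms(1)
    by (auto simp: norm_one_diag_iff commutant_inverse norm_inverse mat2_eq_iff matrix_mult_nth2
        mat_1_eq_diag2 simp flip: inverse_mult_distrib)
  show grp: "group Z"
  proof (rule groupI)
    show "M \<otimes>\<^bsub>Z\<^esub> N \<in> carrier Z" if "M \<in> carrier Z" "N \<in> carrier Z" for M N
    proof -
      have "norm (M$1$1) * norm (N$1$1) * (norm (M$2$2) * norm (N$2$2)) =
          (norm (M$1$1) * norm (M$2$2)) * (norm (N$1$1) * norm (N$2$2))"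
        by (simp add: ac_simps)
      with that show ?thesis
        unfolding assms by (simp add: norm_one_diag_iff commutant_mult matrix_mult_nth2 norm_mult)
    qed
    show "\<one>\<^bsub>Z\<^esub> \<in> carrier Z"
      unfolding assms by (simp add: norm_one_diag_iff mat_1_eq_diag2 commutant_1)
    show "\<exists>N\<in>carrier Z. N \<otimes>\<^bsub>Z\<^esub> M = \<one>\<^bsub>Z\<^esub>" if "M \<in> carrier Z" for M
      using inverse_closed[OF that] inverse_left[OF that] assms by auto
  qed (simp_all add: assms matrix_mul_assoc)
  show "inv\<^bsub>Z\<^esub> M = diag2 (inverse (M$1$1)) (inverse (M$2$2))" if "M \<in> carrier Z"
    using group.inv_equality[OF grp _ that inverse_closed[OF that]] inverse_left[OF that]
    by (simp add: assms)
qed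

lemma norm_one_diag_lie_group:
  assumes "carrier Z = norm_one_diag (commutant x) (commutant y)"
    and "mult Z = (**)" and "one Z = mat 1"
  shows "lie_group (dim (commutant x) + dim (commutant y) - 1) Z"
  unfolding lie_group_def
proof (intro conjI)
  show "group Z" by (rule norm_one_diag_group[OF assms])
  show "embedded_submanifold (dim (commutant x) + dim (commutant y) - 1) (carrier Z)"
    unfolding assms by (intro embedded_submanifold_norm_one_diag subspace_commutant)
  show "smooth_map (carrier Z \<times> carrier Z) (\<lambda>(M, N). M \<otimes>\<^bsub>Z\<^esub> N)"
  proof (rule smooth_mapI)
    have "smooth_on UNIV (\<lambda>MN :: (quat^2^2) \<times> (quat^2^2). fst MN $ i $ i)"
      "smooth_on UNIV (\<lambda>MN :: (quat^2^2) \<times> (quat^2^2). snd MN $ i $ i)" for i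
      using bounded_linear_compose[OF entry_bounded_linear bounded_linear_fst]
        bounded_linear_compose[OF entry_bounded_linear bounded_linear_snd]
      by (auto intro!: smooth_on_linear)
    then show "smooth_on UNIV (\<lambda>MN :: (quat^2^2) \<times> (quat^2^2). diag2 (fst MN $1$1 * snd MN $1$1) (fst MN $2$2 * snd MN $2$2))"
      by (intro smooth_on_diag2 smooth_on_mult) auto
  qed (auto simp: assms norm_one_diag_def)
  show "smooth_map (carrier Z) (\<lambda>M. inv\<^bsub>Z\<^esub> M)"
  proof (rule smooth_mapI)
    let ?U = "{M :: quat^2^2. M$1$1 \<noteq> 0 \<and> M$2$2 \<noteq> 0}"
    show "open ?U"
      by (intro open_Collect_conj open_Collect_neq continuous_intros)
    then show "smooth_on ?U (\<lambda>M. diag2 (inverse (M$1$1)) (inverse (M$2$2)))"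
      by (intro smooth_on_diag2 smooth_on_inverse_quat smooth_on_linear[OF entry_bounded_linear]) auto
    show "carrier Z \<subseteq> ?U"
      by (auto simp: assms norm_one_diag_iff)
  qed (simp add: norm_one_diag_group(2)[OF assms])
qed

section \<open>Complex lines in the quaternions\<close>

definition quat_of_complex :: "quat \<Rightarrow> complex \<Rightarrow> quat"
  where "quat_of_complex I z = of_real (Re z) + Im z *\<^sub>R I"

text \<open>
  A left inverse of \<open>quat_of_complex I\<close> for a unit \<open>I\<close>, defined linearly on all quaternions so
  that its smoothness is immediate.
\<close>

definition complex_coord :: "quat \<Rightarrow> quat \<Rightarrow> complex"
  where "complex_coord I q = Complex (qre q) (q \<bullet> I)"

lemma imag_units_iff:
  "I \<in> imag_units \<longleftrightarrow> qre I = 0 \<and> (qi I)\<^sup>2 + (qj I)\<^sup>2 + (qk I)\<^sup>2 = 1"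
proof
  assume "I \<in> imag_units"
  then have *: "qre I * qre I - qi I * qi I - qj I * qj I - qk I * qk I = -1"
    "qre I * qi I = 0" "qre I * qj I = 0" "qre I * qk I = 0"
    by (auto simp: imag_units_def quat_eq_iff)
  have "qre I = 0"
  proof (rule ccontr)
    assume "qre I \<noteq> 0"
    with * have "qre I * qre I = -1" by auto
    then show False by (metis zero_le_square not_one_le_zero neg_0_le_iff_le)
  qed
  with * show "qre I = 0 \<and> (qi I)\<^sup>2 + (qj I)\<^sup>2 + (qk I)\<^sup>2 = 1"
    by (simp add: power2_eq_square)
next
  assume "qre I = 0 \<and> (qi I)\<^sup>2 + (qj I)\<^sup>2 + (qk I)\<^sup>2 = 1"
  then show "I \<in> imag_units"
    by (simp add: imag_units_def quat_eq_iff power2_eq_square)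
qed

lemma imag_unit_nonreal: "I \<in> imag_units \<Longrightarrow> I \<notin> \<real>"
  by (auto simp: imag_units_iff quat_Reals_iff)

lemma commutant_imag_unit: "I \<in> imag_units \<Longrightarrow> commutant I = range (quat_of_complex I)"
proof -
  assume "I \<in> imag_units"
  then have "commutant I = {of_real a + b *\<^sub>R I | a b. True}"
    by (intro commutant_nonreal imag_unit_nonreal)
  also have "\<dots> = range (quat_of_complex I)"
  proof (intro equalityI subsetI)
    fix q assume "q \<in> {of_real a + b *\<^sub>R I | a b. True}"
    then obtain a b where "q = quat_of_complex I (Complex a b)"
      by (auto simp: quat_of_complex_def)
    then show "q \<in> range (quat_of_complex I)" by blast
  qed (auto simp: quat_of_complex_def)
  finally show ?thesis .
qed

lemma quat_of_complex_mult:
  assumes "I \<in> imag_units"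
  shows "quat_of_complex I (z * w) = quat_of_complex I z * quat_of_complex I w"
proof -
  have "I * I = -1" using assms by (simp add: imag_units_def)
  then show ?thesis
    by (simp add: quat_of_complex_def of_real_def algebra_simps)
qed

lemma norm_quat_of_complex:
  assumes "I \<in> imag_units"
  shows "norm (quat_of_complex I z) = norm z"
proof -
  have "(norm (quat_of_complex I z))\<^sup>2 =
      (Re z)\<^sup>2 + (Im z)\<^sup>2 * ((qi I)\<^sup>2 + (qj I)\<^sup>2 + (qk I)\<^sup>2)"
    using assms by (simp add: quat_norm_sq quat_of_complex_def imag_units_iff power_mult_distrib flip: distrib_left)
  also have "\<dots> = (norm z)\<^sup>2"
    using assms by (simp add: imag_units_iff cmod_power2)
  finally show ?thesis by simp
qed

lemma complex_coord_quat_of_complex [simp]: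
  assumes "I \<in> imag_units"
  shows "complex_coord I (quat_of_complex I z) = z"
proof -
  have "quat_of_complex I z \<bullet> I = Im z * ((qi I)\<^sup>2 + (qj I)\<^sup>2 + (qk I)\<^sup>2)"
    using assms
    by (simp add: inner_quat_def quat_of_complex_def imag_units_iff power2_eq_square mult.assoc
        flip: distrib_left)
  then show ?thesis
    using assms by (simp add: complex_coord_def imag_units_iff quat_of_complex_def)
qed

lemma quat_of_complex_rcis: "quat_of_complex I (rcis r \<theta>) = of_real r * qexp I \<theta>"
  by (simp add: quat_of_complex_def qexp_def of_real_def algebra_simps)

lemma quat_of_complex_bounded_linear: "bounded_linear (quat_of_complex I)"
  by (simp add: linear_conv_bounded_linear[symmetric] linear_iff quat_of_complex_def of_real_def algebra_simps)

lemma complex_coord_bounded_linear: "bounded_linear (complex_coord I)"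
  by (simp add: linear_conv_bounded_linear[symmetric] linear_iff complex_coord_def complex_eq_iff inner_add_left)

text \<open>
  Adding a real number to a quaternion, or scaling it by a nonzero real, does not change its
  commutant, and \<open>sin \<theta> \<noteq> 0\<close> guarantees that \<open>I\<close> really occurs.
\<close>

lemma polar_commutant:
  assumes "r > 0" "\<theta> \<in> {0<..<pi}" "I \<in> imag_units"
  shows "of_real r * qexp I \<theta> \<notin> \<real>"
    and "commutant (of_real r * qexp I \<theta>) = range (quat_of_complex I)"
proof -
  have s: "r * sin \<theta> \<noteq> 0" using assms sin_gt_zero[of \<theta>] by simp
  have eq: "of_real r * qexp I \<theta> = of_real (r * cos \<theta>) + (r * sin \<theta>) *\<^sub>R I"
    by (simp add: qexp_def of_real_def algebra_simps)
  show "of_real r * qexp I \<theta> \<notin> \<real>"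
    using imag_unit_nonreal[OF assms(3)] s unfolding eq by (auto simp: quat_Reals_iff)
  have "commutant (of_real r * qexp I \<theta>) = commutant I"
    unfolding eq commutant_def using s by (simp add: algebra_simps of_real_def)
  then show "commutant (of_real r * qexp I \<theta>) = range (quat_of_complex I)"
    by (simp add: commutant_imag_unit assms)
qed

lemma norm_one_diag_polar:
  assumes "I \<in> imag_units" "J \<in> imag_units"
  shows "norm_one_diag (range (quat_of_complex I)) (range (quat_of_complex J)) =
    {diag2 (of_real t * qexp I \<sigma>) (of_real (inverse t) * qexp J \<tau>) | t \<sigma> \<tau>. t > 0}"
proof (intro equalityI subsetI)
  fix M assume "M \<in> norm_one_diag (range (quat_of_complex I)) (range (quat_of_complex J))"
  then obtain z w where zw: "M = diag2 (quat_of_complex I z) (quat_of_complex J w)" "norm z * norm w = 1"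
    using assms by (auto simp: norm_one_diag_def norm_quat_of_complex)
  then have "norm z > 0" "norm w = inverse (norm z)"
    by (auto simp: divide_inverse[of 1, simplified, symmetric] eq_divide_eq mult.commute)
  then have "M = diag2 (of_real (norm z) * qexp I (Arg z)) (of_real (inverse (norm z)) * qexp J (Arg w))"
    using zw(1) rcis_cmod_Arg[of z] rcis_cmod_Arg[of w]
    by (metis quat_of_complex_rcis)
  with \<open>norm z > 0\<close> show "M \<in> {diag2 (of_real t * qexp I \<sigma>) (of_real (inverse t) * qexp J \<tau>) | t \<sigma> \<tau>. t > 0}"
    by blast
next
  fix M assume "M \<in> {diag2 (of_real t * qexp I \<sigma>) (of_real (inverse t) * qexp J \<tau>) | t \<sigma> \<tau>. t > 0}"
  then obtain t \<sigma> \<tau> where "t > 0"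
    "M = diag2 (quat_of_complex I (rcis t \<sigma>)) (quat_of_complex J (rcis (inverse t) \<tau>))"
    by (auto simp: quat_of_complex_rcis)
  then show "M \<in> norm_one_diag (range (quat_of_complex I)) (range (quat_of_complex J))"
    using assms by (auto simp: norm_one_diag_iff norm_quat_of_complex)
qed

text \<open>
  The inverse isomorphism \<open>k\<close> sends \<open>(t, z, w)\<close> to \<open>diag2 (t z) (w / t)\<close>, with \<open>z\<close> and \<open>w\<close> read
  in the complex lines through \<open>I\<close> and \<open>J\<close>. Multiplicativity is evident for \<open>k\<close>, and \<open>h\<close>
  inherits it.
\<close>

lemma norm_one_diag_lie_isomorphic:
  assumes Z: "carrier Z = norm_one_diag (range (quat_of_complex I)) (range (quat_of_complex J))"
    and mult: "mult Z = (**)" and IJ: "I \<in> imag_units" "J \<in> imag_units"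
  shows "lie_isomorphic Z (pos_reals \<times>\<times> U1 \<times>\<times> U1)"
proof -
  let ?G = "pos_reals \<times>\<times> U1 \<times>\<times> U1"
  define k where "k = (\<lambda>(t, z, w). diag2 (t *\<^sub>R quat_of_complex I z) (inverse t *\<^sub>R quat_of_complex J w))"
  \<comment> \<open>On the carrier \<open>1 / norm (M$2$2)\<close> equals \<open>norm (M$1$1)\<close>, so only one norm has to be nonzero.\<close>
  define h where "h = (\<lambda>M :: quat^2^2. (norm (M$1$1),
    inverse (norm (M$1$1)) *\<^sub>R complex_coord I (M$1$1), norm (M$1$1) *\<^sub>R complex_coord J (M$2$2)))"
  have G: "carrier ?G = {(t, z, w). t > 0 \<and> norm z = 1 \<and> norm w = 1}"
    by (auto simp: pos_reals_def U1_def)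
  have scale: "r *\<^sub>R quat_of_complex K z = quat_of_complex K (r *\<^sub>R z)"
    "r *\<^sub>R complex_coord K q = complex_coord K (r *\<^sub>R q)" for r K z q
    by (simp_all add: quat_of_complex_bounded_linear complex_coord_bounded_linear
        bounded_linear.linear linear_scale)
  have k_Z: "k x \<in> carrier Z" and h_k: "h (k x) = x" if "x \<in> carrier ?G" for x
  proof -
    obtain t z w where x: "x = (t, z, w)" "t > 0" "norm z = 1" "norm w = 1"
      using \<open>x \<in> carrier ?G\<close> unfolding G by auto
    show "k x \<in> carrier Z" "h (k x) = x"
      using x IJ
      by (simp_all add: Z norm_one_diag_iff k_def h_def norm_quat_of_complex scale)
  qed
  have h_G: "h M \<in> carrier ?G" and k_h: "k (h M) = M" if M: "M \<in> carrier Z" for M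
  proof -
    obtain z w where zw: "M = diag2 (quat_of_complex I z) (quat_of_complex J w)" "norm z * norm w = 1"
      using M IJ unfolding Z by (auto simp: norm_one_diag_def norm_quat_of_complex)
    then have nz: "z \<noteq> 0" by auto
    have h: "h M = (norm z, inverse (norm z) *\<^sub>R z, norm z *\<^sub>R w)"
      using IJ by (simp add: h_def zw norm_quat_of_complex)
    show "h M \<in> carrier ?G"
      unfolding h G using nz zw by simp
    show "k (h M) = M"
      unfolding h k_def using nz zw(1) by (simp add: scale)
  qed
  have bij: "bij_betw h (carrier Z) (carrier ?G)"
    by (rule bij_betw_byWitness[where f' = k]) (use k_Z h_k h_G k_h in \<open>blast+\<close>)
  have k_mult: "k (x \<otimes>\<^bsub>?G\<^esub> y) = k x ** k y" for x y
    by (cases x; cases y)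
       (simp add: k_def pos_reals_def U1_def quat_of_complex_mult IJ)
  have k_closed: "x \<otimes>\<^bsub>?G\<^esub> y \<in> carrier ?G" if "x \<in> carrier ?G" "y \<in> carrier ?G" for x y
    using that by (auto simp: pos_reals_def U1_def norm_mult)
  have "h (M \<otimes>\<^bsub>Z\<^esub> N) = h M \<otimes>\<^bsub>?G\<^esub> h N" if "M \<in> carrier Z" "N \<in> carrier Z" for M N
    by (metis mult that k_h h_G k_mult k_closed h_k)
  with bij h_G have "h \<in> iso Z ?G" by (auto simp: iso_def hom_def)
  moreover have "smooth_map (carrier Z) h"
  proof (rule smooth_mapI)
    let ?U = "{M :: quat^2^2. M$1$1 \<noteq> 0}"
    show U: "open ?U"
      by (intro open_Collect_neq continuous_intros)
    note entry = smooth_on_linear[OF entry_bounded_linear U]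
    show "smooth_on ?U h"
      unfolding h_def
      by (intro smooth_on_Pair smooth_on_norm smooth_on_scaleR smooth_on_inverse_real U entry
          smooth_on_bounded_linear[OF complex_coord_bounded_linear]) auto
  qed (auto simp: Z norm_one_diag_iff)
  moreover have "smooth_map (carrier ?G) (inv_into (carrier Z) h)"
  proof (rule smooth_mapI)
    let ?U = "{x :: real \<times> complex \<times> complex. fst x \<noteq> 0}"
    show U: "open ?U"
      by (intro open_Collect_neq continuous_intros)
    have lin: "bounded_linear (\<lambda>x :: real \<times> complex \<times> complex. fst (snd x))"
      "bounded_linear (\<lambda>x :: real \<times> complex \<times> complex. snd (snd x))"
      by (intro bounded_linear_fst_comp bounded_linear_snd_comp bounded_linear_snd)+
    have "smooth_on ?U (\<lambda>x. diag2 (fst x *\<^sub>R quat_of_complex I (fst (snd x)))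
        (inverse (fst x) *\<^sub>R quat_of_complex J (snd (snd x))))"
      by (intro smooth_on_diag2 smooth_on_scaleR smooth_on_inverse_real U
          smooth_on_bounded_linear[OF quat_of_complex_bounded_linear]
          smooth_on_linear[OF bounded_linear_fst] lin[THEN smooth_on_linear]) auto
    then show "smooth_on ?U k" by (simp add: k_def case_prod_beta')
    show "carrier ?G \<subseteq> ?U" unfolding G by auto
    show "k x = inv_into (carrier Z) h x" if "x \<in> carrier ?G" for x
      using bij k_Z[OF that] h_k[OF that] by (metis bij_betw_def inv_into_f_f)
  qed
  ultimately show ?thesis
    unfolding lie_isomorphic_def by blast
qed

section \<open>Conjugacy of diagonal matrices\<close>

text \<open>
  For \<open>x \<noteq> 0\<close> the elements \<open>1 - x * y\<close> and \<open>1 - y * x\<close> are conjugate by \<open>x\<close>.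
\<close>

lemma norm_one_minus_mult_commute: "norm (1 - x * y) = norm (1 - y * x)"
  for x y :: "'a::real_normed_div_algebra"
proof (cases "x = 0")
  case False
  have "x * (1 - y * x) = (1 - x * y) * x" by (simp add: algebra_simps)
  then have "norm x * norm (1 - y * x) = norm (1 - x * y) * norm x"
    by (metis norm_mult)
  then show ?thesis using False by simp
qed simp

text \<open>
  The determinant can also be computed with the lower right entry as pivot. If both diagonal
  entries are nonzero, the two formulas are \<open>norm a * norm d\<close> times the norms of \<open>1 - x * y\<close> and
  \<open>1 - y * x\<close>, where \<open>x = inverse d * c\<close> and \<open>y = inverse a * b\<close>.
\<close>

lemma dieudonne_det_second_pivot:
  "dieudonne_det M = (if M$2$2 = 0 then norm (M$1$2) * norm (M$2$1)
    else norm (M$2$2) * norm (M$1$1 - M$1$2 * inverse (M$2$2) * M$2$1))"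
proof -
  define a b c d where abcd: "a = M$1$1" "b = M$1$2" "c = M$2$1" "d = M$2$2"
  have "norm (a * d - a * c * inverse a * b) = norm d * norm (a - b * inverse d * c)"
    if "a \<noteq> 0" "d \<noteq> 0"
  proof -
    define x y where "x = inverse d * c" and "y = inverse a * b"
    have "a * d - a * c * inverse a * b = a * d * (1 - x * y)"
      "a - b * inverse d * c = a * (1 - y * x)"
      using that by (simp_all add: x_def y_def right_diff_distrib mult.assoc[symmetric])
        (simp_all add: mult.assoc)
    then show ?thesis
      by (simp add: norm_mult norm_one_minus_mult_commute[of x y])
  qed
  then show ?thesis
    unfolding dieudonne_det_def Let_def abcd[symmetric]
    by (auto simp: norm_mult norm_inverse)
qed

text \<open>
  If \<open>g\<close> has pivot \<open>a \<noteq> 0\<close>, the lower right entry \<open>l\<close> of \<open>h\<close> is inverse to the Schur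
  complement of \<open>a\<close> in \<open>g\<close>, and dually \<open>a\<close> is inverse to the Schur complement of \<open>l\<close> in \<open>h\<close>.
  So \<open>g\<close> is to be expanded along its upper left and \<open>h\<close> along its lower right entry.
\<close>

lemma dieudonne_det_inverse:
  assumes gh: "g ** h = mat 1" and hg: "h ** g = mat 1"
  shows "dieudonne_det g * dieudonne_det h = 1"
proof -
  define a b c d where abcd: "a = g$1$1" "b = g$1$2" "c = g$2$1" "d = g$2$2"
  define e f k l where efkl: "e = h$1$1" "f = h$1$2" "k = h$2$1" "l = h$2$2"
  have eqs: "a * e + b * k = 1" "a * f + b * l = 0" "c * e + d * k = 0" "c * f + d * l = 1"
    "e * a + f * c = 1" "e * b + f * d = 0" "k * a + l * c = 0" "k * b + l * d = 1"
    using gh hg by (simp_all add: mat2_eq_iff matrix_mult_nth2 mat_1_eq_diag2 abcd efkl)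
  show ?thesis
  proof (cases "a = 0")
    case True
    with eqs have "b * k = 1" "b * l = 0" by auto
    then have "l = 0" "c * f = 1" using eqs by auto
    moreover have "norm b * norm k = 1" "norm c * norm f = 1"
      using \<open>b * k = 1\<close> \<open>c * f = 1\<close> by (metis norm_mult norm_one)+
    then have "norm c * norm b * (norm f * norm k) = 1"
      by (metis mult.assoc mult.commute mult.left_neutral)
    ultimately show ?thesis
      using True by (simp add: dieudonne_det_second_pivot[of h] dieudonne_det_def[of g] Let_def
          flip: abcd efkl) (simp add: norm_mult)
  next
    case False
    have k: "k = - (l * c * inverse a)"
    proof -
      have "k * a = - (l * c)" using eqs by (simp add: eq_neg_iff_add_eq_0)
      then have "k * a * inverse a = - (l * c) * inverse a" by simp
      then show ?thesis using False by (simp add: mult.assoc)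
    qed
    have l1: "l * (d - c * inverse a * b) = 1"
      using eqs(8) unfolding k by (simp add: algebra_simps)
    then have l: "l \<noteq> 0" by auto
    have "f = - (inverse a * b * l)"
    proof -
      have "a * f = - (b * l)" using eqs by (simp add: eq_neg_iff_add_eq_0)
      then have "inverse a * (a * f) = - (inverse a * (b * l))" by simp
      then show ?thesis using False by (simp add: mult.assoc[symmetric])
    qed
    then have "a * (e - f * inverse l * k) = a * e + b * k"
      using False l by (simp add: algebra_simps) (simp add: mult.assoc[symmetric])
    then have "a * (e - f * inverse l * k) = 1" using eqs(1) by simp
    then have 1: "norm a * norm (e - f * inverse l * k) = 1"
      by (metis norm_mult norm_one)
    have 2: "norm l * norm (d - c * inverse a * b) = 1"
      using l1 by (metis norm_mult norm_one)
    have "dieudonne_det g = norm a * norm (d - c * inverse a * b)"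
      using False by (simp add: dieudonne_det_def Let_def right_diff_distrib mult.assoc flip: abcd norm_mult)
    moreover have "dieudonne_det h = norm l * norm (e - f * inverse l * k)"
      using l by (simp add: dieudonne_det_second_pivot flip: efkl)
    ultimately have "dieudonne_det g * dieudonne_det h =
        (norm a * norm (e - f * inverse l * k)) * (norm l * norm (d - c * inverse a * b))"
      by simp
    then show ?thesis unfolding 1 2 by simp
  qed
qed

lemma conjugate_in_SL2H_imp:
  assumes "conjugate_in SL2H A D"
  obtains g h where "D ** g = g ** A" "g ** h = mat 1" "h ** g = mat 1"
proof -
  obtain g where g: "g \<in> carrier SL2H" "D = g ** A ** inv\<^bsub>SL2H\<^esub> g"
    using assms by (auto simp: conjugate_in_def SL2H_def GL2H_def)
  then obtain h where gh: "g ** h = mat 1" "h ** g = mat 1"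
    by (auto simp: SL2H_def GL2H_def invertible_def)
  have "dieudonne_det h = 1"
    using dieudonne_det_inverse[OF gh] g(1) by (simp add: SL2H_def)
  then have h: "h \<in> carrier SL2H"
    using gh by (auto simp: SL2H_def GL2H_def invertible_def)
  have "inv\<^bsub>SL2H\<^esub> g = h"
    unfolding m_inv_def
  proof (rule the_equality)
    show "h \<in> carrier SL2H \<and> g \<otimes>\<^bsub>SL2H\<^esub> h = \<one>\<^bsub>SL2H\<^esub> \<and> h \<otimes>\<^bsub>SL2H\<^esub> g = \<one>\<^bsub>SL2H\<^esub>"
      using h gh by (simp add: SL2H_def GL2H_def)
    show "y = h" if "y \<in> carrier SL2H \<and> g \<otimes>\<^bsub>SL2H\<^esub> y = \<one>\<^bsub>SL2H\<^esub> \<and> y \<otimes>\<^bsub>SL2H\<^esub> g = \<one>\<^bsub>SL2H\<^esub>" for y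
    proof -
      have "y = y ** (g ** h)" by (simp add: gh)
      also have "\<dots> = h" using that by (simp add: matrix_mul_assoc SL2H_def GL2H_def)
      finally show ?thesis .
    qed
  qed
  then have "D ** g = g ** A"
    using g(2) gh by (simp add: matrix_mul_assoc[symmetric])
  with gh that show ?thesis by blast
qed

lemma quat_similar_iff: "quat_similar x y \<longleftrightarrow> (\<exists>p. p \<noteq> 0 \<and> y * p = p * x)"
proof -
  have "y = p * x * inverse p \<longleftrightarrow> y * p = p * x" if "p \<noteq> 0" for p
    using that by (metis mult.assoc left_inverse right_inverse mult_1_right)
  then show ?thesis unfolding quat_similar_def by blast
qed

lemma quat_similar_sym: "quat_similar x y \<Longrightarrow> quat_similar y x"
proof -
  assume "quat_similar x y"
  then obtain p where p: "p \<noteq> 0" "y * p = p * x" by (auto simp: quat_similar_iff)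
  have "x * inverse p = inverse p * (p * x) * inverse p"
    using p(1) by (simp add: mult.assoc[symmetric])
  also have "\<dots> = inverse p * y"
    using p(1) by (simp add: p(2)[symmetric] mult.assoc)
  finally show ?thesis using p(1) unfolding quat_similar_iff
    by (metis nonzero_imp_inverse_nonzero)
qed

lemma quat_similar_trans: "quat_similar x y \<Longrightarrow> quat_similar y z \<Longrightarrow> quat_similar x z"
  unfolding quat_similar_iff by (metis mult.assoc no_zero_divisors)

text \<open>
  Each nonzero entry of the conjugating matrix is an intertwiner between one of \<open>lam, mu\<close> and one
  of \<open>d1, d2\<close>. Invertibility supplies nonzero entries in every row and column, and \<open>lam\<close> and
  \<open>mu\<close> cannot both be similar to the same \<open>d1\<close>.
\<close>

lemma conjugate_diag2_imp_similar:
  assumes "conjugate_in SL2H (diag2 lam mu) (diag2 d1 d2)" and "\<not> quat_similar lam mu"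
  shows "quat_similar lam d1 \<and> quat_similar mu d2 \<or> quat_similar lam d2 \<and> quat_similar mu d1"
proof -
  obtain g h where gh: "diag2 d1 d2 ** g = g ** diag2 lam mu" "g ** h = mat 1" "h ** g = mat 1"
    using assms(1) by (rule conjugate_in_SL2H_imp)
  have sim: "g$1$1 \<noteq> 0 \<Longrightarrow> quat_similar lam d1" "g$1$2 \<noteq> 0 \<Longrightarrow> quat_similar mu d1"
    "g$2$1 \<noteq> 0 \<Longrightarrow> quat_similar lam d2" "g$2$2 \<noteq> 0 \<Longrightarrow> quat_similar mu d2"
    using gh(1) by (auto simp: mat2_eq_iff matrix_mult_nth2 quat_similar_iff)
  have nz: "g$1$1 \<noteq> 0 \<or> g$1$2 \<noteq> 0" "g$1$1 \<noteq> 0 \<or> g$2$1 \<noteq> 0" "g$1$2 \<noteq> 0 \<or> g$2$2 \<noteq> 0"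
    using gh(2,3) by (auto simp: mat2_eq_iff matrix_mult_nth2 mat_1_eq_diag2)
  show ?thesis
  proof (cases "g$1$1 = 0")
    case True
    then show ?thesis using sim nz by blast
  next
    case False
    then have "\<not> quat_similar mu d1"
      using sim(1) assms(2) quat_similar_trans quat_similar_sym by blast
    then show ?thesis using False sim nz by blast
  qed
qed

lemma quat_similar_polar:
  assumes "quat_similar x (of_real r * qexp I \<theta>)" "I \<in> imag_units"
  shows "\<exists>I'\<in>imag_units. x = of_real r * qexp I' \<theta>"
proof -
  obtain p where p: "p \<noteq> 0" "x = p * (of_real r * qexp I \<theta>) * inverse p"
    using quat_similar_sym[OF assms(1)] by (auto simp: quat_similar_def)
  define I' where "I' = p * I * inverse p"
  have "I' * I' = p * (I * I) * inverse p"
    unfolding I'_def using p(1) by (simp add: mult.assoc) (simp add: mult.assoc[symmetric])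
  also have "\<dots> = -1" using assms(2) p(1) by (simp add: imag_units_def)
  finally have "I' \<in> imag_units" by (simp add: imag_units_def)
  moreover have "x = of_real r * qexp I' \<theta>"
    unfolding p(2) qexp_def I'_def using p(1)
    by (simp add: of_real_def algebra_simps)
  ultimately show ?thesis by blast
qed

lemma quat_similar_real: "quat_similar x y \<Longrightarrow> y \<in> \<real> \<Longrightarrow> x \<in> \<real>"
proof -
  assume "quat_similar x y" "y \<in> \<real>"
  then obtain p a where "p \<noteq> 0" "x = p * of_real a * inverse p"
    using quat_similar_sym[of x y] by (auto simp: quat_similar_def elim!: Reals_cases)
  then have "x = of_real a" by (simp add: of_real_def)
  then show ?thesis by simp
qed

section \<open>Centralizers of diagonal matrices\<close>

lemma centralizer_H_star: "centralizer H_star x = commutant x - {0}"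
  by (auto simp: centralizer_def H_star_def commutant_def)

lemma centralizer_GL2H_diag2:
  assumes "\<not> quat_similar lam mu"
  shows "centralizer GL2H (diag2 lam mu) =
    {diag2 q p | q p. q \<in> centralizer H_star lam \<and> p \<in> centralizer H_star mu}"
proof (intro equalityI subsetI)
  fix g assume "g \<in> centralizer GL2H (diag2 lam mu)"
  then have g: "invertible g" "g ** diag2 lam mu = diag2 lam mu ** g"
    by (auto simp: centralizer_def GL2H_def)
  then have c: "g$1$1 * lam = lam * g$1$1" "g$1$2 * mu = lam * g$1$2" "g$2$1 * lam = mu * g$2$1"
    "g$2$2 * mu = mu * g$2$2"
    by (simp_all add: mat2_eq_iff matrix_mult_nth2)
  have off: "g$1$2 = 0" "g$2$1 = 0"
    using c(2,3) assms quat_similar_sym[of mu lam] by (metis quat_similar_iff)+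
  then have eq: "g = diag2 (g$1$1) (g$2$2)" by (simp add: mat2_eq_iff)
  then have "g$1$1 \<noteq> 0" "g$2$2 \<noteq> 0" using g(1) invertible_diag2_iff by metis+
  with c eq show "g \<in> {diag2 q p | q p. q \<in> centralizer H_star lam \<and> p \<in> centralizer H_star mu}"
    unfolding centralizer_H_star commutant_def by blast
next
  fix g assume "g \<in> {diag2 q p | q p. q \<in> centralizer H_star lam \<and> p \<in> centralizer H_star mu}"
  then show "g \<in> centralizer GL2H (diag2 lam mu)"
    unfolding centralizer_H_star
    by (auto simp: commutant_def centralizer_def GL2H_def invertible_diag2_iff)
qed

lemma centralizer_SL2H_diag2:
  assumes "\<not> quat_similar lam mu"
  shows "centralizer SL2H (diag2 lam mu) = norm_one_diag (commutant lam) (commutant mu)"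
proof -
  have "centralizer SL2H (diag2 lam mu) = {g \<in> centralizer GL2H (diag2 lam mu). dieudonne_det g = 1}"
    by (auto simp: centralizer_def SL2H_def)
  then show ?thesis
    unfolding centralizer_GL2H_diag2[OF assms] centralizer_H_star
    by (auto simp: norm_one_diag_def)
qed

text \<open>
  Conjugacy may swap the two entries, and then \<open>lam\<close> has modulus less than \<open>1\<close>; this is why the
  conclusion asks only for \<open>r > 0\<close>.
\<close>

lemma regular_loxodromic_diag2_polar:
  assumes "regular_loxodromic (diag2 lam mu)" "\<not> quat_similar lam mu"
  shows "\<exists>r \<theta> \<phi> I J. r > 0 \<and> \<theta> \<in> {0<..<pi} \<and> \<phi> \<in> {0<..<pi} \<and>
    I \<in> imag_units \<and> J \<in> imag_units \<and>
    lam = of_real r * qexp I \<theta> \<and> mu = of_real (inverse r) * qexp J \<phi>"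
proof -
  obtain r \<theta> \<phi> I J where *: "r > 1" "\<theta> \<in> {0<..<pi}" "\<phi> \<in> {0<..<pi}" "I \<in> imag_units" "J \<in> imag_units"
    and conj: "conjugate_in SL2H (diag2 lam mu) (diag2 (of_real r * qexp I \<theta>) (of_real (inverse r) * qexp J \<phi>))"
    using assms(1) unfolding regular_loxodromic_def by blast
  show ?thesis
    using conjugate_diag2_imp_similar[OF conj assms(2)]
  proof
    assume "quat_similar lam (of_real r * qexp I \<theta>) \<and> quat_similar mu (of_real (inverse r) * qexp J \<phi>)"
    then obtain I' J' where "I' \<in> imag_units" "J' \<in> imag_units"
      "lam = of_real r * qexp I' \<theta>" "mu = of_real (inverse r) * qexp J' \<phi>"
      using quat_similar_polar * by metis
    with * show ?thesis
      by (intro exI[of _ r] exI[of _ \<theta>] exI[of _ \<phi>] exI[of _ I'] exI[of _ J']) auto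
  next
    assume "quat_similar lam (of_real (inverse r) * qexp J \<phi>) \<and> quat_similar mu (of_real r * qexp I \<theta>)"
    then obtain I' J' where "I' \<in> imag_units" "J' \<in> imag_units"
      "lam = of_real (inverse r) * qexp J' \<phi>" "mu = of_real r * qexp I' \<theta>"
      using quat_similar_polar * by metis
    with * show ?thesis
      by (intro exI[of _ "inverse r"] exI[of _ \<phi>] exI[of _ \<theta>] exI[of _ J'] exI[of _ I']) auto
  qed
qed

lemma nonregular_loxodromic_diag2_real:
  assumes "loxodromic (diag2 lam mu)" "\<not> regular_loxodromic (diag2 lam mu)" "\<not> quat_similar lam mu"
  shows "lam \<in> \<real> \<or> mu \<in> \<real>"
proof -
  obtain r \<theta> \<phi> I J where *: "r > 1" "\<theta> \<in> {0..pi}" "\<phi> \<in> {0..pi}" "I \<in> imag_units" "J \<in> imag_units"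
    and conj: "conjugate_in SL2H (diag2 lam mu) (diag2 (of_real r * qexp I \<theta>) (of_real (inverse r) * qexp J \<phi>))"
    using assms(1) unfolding loxodromic_def by blast
  have "\<not> (\<theta> \<in> {0<..<pi} \<and> \<phi> \<in> {0<..<pi})"
    using assms(1,2) * conj unfolding regular_loxodromic_def loxodromic_def by blast
  with * have "\<theta> \<in> {0, pi} \<or> \<phi> \<in> {0, pi}" by auto
  then have "of_real r * qexp I \<theta> \<in> \<real> \<or> of_real (inverse r) * qexp J \<phi> \<in> \<real>"
    by (auto simp: qexp_def simp flip: of_real_inverse)
  then show ?thesis
    using conjugate_diag2_imp_similar[OF conj assms(3)] quat_similar_real by blast
qed

theorem proposition4p1:
  fixes lam mu :: quat and A :: "quat^2^2" and Z :: "(quat^2^2) monoid"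
  assumes "A = diag2 lam mu" and "A \<in> carrier SL2H"
    and "\<not> quat_similar lam mu"
    and "Z = SL2H\<lparr>carrier := centralizer SL2H A\<rparr>"
  shows "centralizer GL2H A =
      {diag2 q p | q p. q \<in> centralizer H_star lam \<and> p \<in> centralizer H_star mu} \<and>
    (regular_loxodromic A \<longrightarrow>
      (\<exists>r \<theta> \<phi> I J. r > 0 \<and> \<theta> \<in> {0<..<pi} \<and> \<phi> \<in> {0<..<pi} \<and>
         I \<in> imag_units \<and> J \<in> imag_units \<and>
         lam = of_real r * qexp I \<theta> \<and> mu = of_real (inverse r) * qexp J \<phi>) \<and>
      (\<forall>r \<theta> \<phi> I J. r > 0 \<and> \<theta> \<in> {0<..<pi} \<and> \<phi> \<in> {0<..<pi} \<and>
         I \<in> imag_units \<and> J \<in> imag_units \<and>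
         lam = of_real r * qexp I \<theta> \<and> mu = of_real (inverse r) * qexp J \<phi> \<longrightarrow>
         centralizer SL2H A =
           {diag2 (of_real t * qexp I \<sigma>) (of_real (inverse t) * qexp J \<tau>) | t \<sigma> \<tau>. t > 0}) \<and>
      lie_isomorphic Z (pos_reals \<times>\<times> U1 \<times>\<times> U1) \<and>
      lie_group 3 Z) \<and>
    (loxodromic A \<and> \<not> regular_loxodromic A \<longrightarrow>
      ((lam \<in> \<real>) \<noteq> (mu \<in> \<real>) \<and> lie_group 5 Z) \<or>
      (lam \<in> \<real> \<and> mu \<in> \<real> \<and> lie_group 7 Z))"
proof (intro conjI impI allI)
  note A = assms(1) and not_similar = assms(3)
  have SL: "centralizer SL2H A = norm_one_diag (commutant lam) (commutant mu)"
    unfolding A by (rule centralizer_SL2H_diag2[OF not_similar])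
  have Z: "carrier Z = norm_one_diag (commutant lam) (commutant mu)" "mult Z = (**)" "one Z = mat 1"
    unfolding assms(4) SL by (simp_all add: SL2H_def GL2H_def)
  note lie = norm_one_diag_lie_group[OF Z]
  show "centralizer GL2H A =
      {diag2 q p | q p. q \<in> centralizer H_star lam \<and> p \<in> centralizer H_star mu}"
    unfolding A by (rule centralizer_GL2H_diag2[OF not_similar])
  show "centralizer SL2H A =
      {diag2 (of_real t * qexp I \<sigma>) (of_real (inverse t) * qexp J \<tau>) | t \<sigma> \<tau>. t > 0}"
    if "r > 0 \<and> \<theta> \<in> {0<..<pi} \<and> \<phi> \<in> {0<..<pi} \<and> I \<in> imag_units \<and> J \<in> imag_units \<and>
      lam = of_real r * qexp I \<theta> \<and> mu = of_real (inverse r) * qexp J \<phi>" for r \<theta> \<phi> I J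
    unfolding SL using that polar_commutant(2)[of r \<theta> I] polar_commutant(2)[of "inverse r" \<phi> J]
    by (simp add: norm_one_diag_polar)
  {
    assume "regular_loxodromic A"
    then show polar: "\<exists>r \<theta> \<phi> I J. r > 0 \<and> \<theta> \<in> {0<..<pi} \<and> \<phi> \<in> {0<..<pi} \<and>
       I \<in> imag_units \<and> J \<in> imag_units \<and>
       lam = of_real r * qexp I \<theta> \<and> mu = of_real (inverse r) * qexp J \<phi>"
      unfolding A by (rule regular_loxodromic_diag2_polar[OF _ not_similar])
    then obtain r \<theta> \<phi> I J where p: "r > 0" "\<theta> \<in> {0<..<pi}" "\<phi> \<in> {0<..<pi}"
      "I \<in> imag_units" "J \<in> imag_units"
      "lam = of_real r * qexp I \<theta>" "mu = of_real (inverse r) * qexp J \<phi>"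
      by blast
    have C: "lam \<notin> \<real>" "commutant lam = range (quat_of_complex I)"
      "mu \<notin> \<real>" "commutant mu = range (quat_of_complex J)"
      using polar_commutant[OF p(1,2,4)] polar_commutant[of "inverse r", OF _ p(3,5)] p by auto
    show "lie_isomorphic Z (pos_reals \<times>\<times> U1 \<times>\<times> U1)"
      by (rule norm_one_diag_lie_isomorphic[OF Z(1)[unfolded C] Z(2) p(4,5)])
    show "lie_group 3 Z"
      using lie by (simp add: dim_commutant_nonreal C(1,3))
  }
  assume "loxodromic A \<and> \<not> regular_loxodromic A"
  then have "lam \<in> \<real> \<or> mu \<in> \<real>"
    unfolding A using nonregular_loxodromic_diag2_real not_similar by blast
  then show "(lam \<in> \<real>) \<noteq> (mu \<in> \<real>) \<and> lie_group 5 Z \<or> lam \<in> \<real> \<and> mu \<in> \<real> \<and> lie_group 7 Z"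
    using lie by (cases "lam \<in> \<real>"; cases "mu \<in> \<real>")
      (simp_all add: dim_commutant_real dim_commutant_nonreal)
qed

end
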